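(* Let $D\ge 0$, $G\ge 0$. Let $\sigma\in C^1([0,1))$ satisfy $\sigma'<0$ on $[0,1)$, $\sigma'\notin L_1(0,1)$, $\sigma_0:=\sigma(0)>0$ and $\sigma'(z)\to-\infty$ as $z\to1$. Put $\varrho(z):=-1/\sigma'(z)$ for $z\in[0,1)$ and $\varrho(1):=0$, and if $G>0$ assume in addition that $\varrho$ is Lipschitz continuous on $[0,z]$ for every $z\in(0,1)$. Then for every $H_*>0$ there is at least one pair of functions $(H,\Gamma):\mathbb{R}\to\mathbb{R}^2$ such that $(h,\gamma)(t,x):=(H,\Gamma)(x-t)$ is a weak solution on $(0,\infty)$ (in the sense defined in the context) to the system $$\partial_t h+\partial_x\Big(-\tfrac{G h^3}{3}\partial_x h+\tfrac{h^2}{2}\sigma'(\gamma)\partial_x\gamma\Big)=0,\qquad \partial_t\gamma+\partial_x\Big(-\tfrac{G h^2}{2}\gamma\,\partial_x h+[h\gamma\sigma'(\gamma)-D]\partial_x\gamma\Big)=0,$$ (i.e. a traveling wave with velocity $c=1$ and profile $(H,\Gamma)$) and $$\lim_{\xi\to-\infty}H(\xi)=2H_*,\quad \lim_{\xi\to\infty}H(\xi)=H_*,\quad \lim_{\xi\to-\infty}\Gamma(\xi)=1,\quad \lim_{\xi\to\infty}\Gamma(\xi)=0,$$ and $\Gamma$ is non-increasing.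
   Context: Weak solution. Given a bounded open interval $I\subset\mathbb{R}$, a pair $(h,\gamma):I\times\mathbb{R}\to\mathbb{R}^2$ is a weak solution of the system on $I$ if: (i) $h\in L_\infty(I,L_{2,loc}(\mathbb{R}))\cap L_2(I,L_{\infty,loc}(\mathbb{R}))$ with $G h^{5/2}\in L_2(I,W^1_{2,loc}(\mathbb{R}))$, and $h\ge0$ a.e. in $I\times\mathbb{R}$; (ii) $\gamma\in L_\infty(I\times\mathbb{R})$ with $D\gamma\in L_2(I,W^1_{2,loc}(\mathbb{R}))$, and $\gamma\in[0,1)$ a.e. in $I\times\mathbb{R}$; (iii) $\sigma(\gamma)\in L_2(I,W^1_{2,loc}(\mathbb{R}))$; (iv) for all $\varphi\in C_0^\infty(I\times\mathbb{R})$, $$\int_I\int_{\mathbb{R}}\Big(h\,\partial_t\varphi+\tfrac{h^2}{2}\partial_x\sigma(\gamma)\,\partial_x\varphi-\tfrac{G}{12}\partial_x h^4\,\partial_x\varphi\Big)dx\,dt=0,$$ $$\int_I\int_{\mathbb{R}}\Big(\gamma\,\partial_t\varphi+h\gamma\,\partial_x\sigma(\gamma)\,\partial_x\varphi-D\,\partial_x\gamma\,\partial_x\varphi-\tfrac{G}{6}\gamma\,\partial_x h^3\,\partial_x\varphi\Big)dx\,dt=0.$$ For an unbounded open interval $I$, $(h,\gamma)$ is a weak solution on $I$ if it is a weak solution on every bounded open subinterval of $I$. (When $G=0$ or $D=0$ the terms multiplied by $G$, respectively $D$, are absent.) *)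

theory Defs
  imports "HOL-Analysis.Analysis" "HOL-Probability.Essential_Supremum"
begin

section \<open>Test functions\<close>

text \<open>\<open>Ck k f\<close>: \<open>f\<close> is \<open>k\<close> times continuously differentiable on the whole space. On \<open>real\<close> the only
  basis vector is \<open>1\<close>; on \<open>real \<times> real\<close> they are \<open>(1, 0)\<close> and \<open>(0, 1)\<close>.\<close>

primrec Ck :: "nat \<Rightarrow> ('a::euclidean_space \<Rightarrow> real) \<Rightarrow> bool" where
  "Ck 0 f \<longleftrightarrow> continuous_on UNIV f"
| "Ck (Suc k) f \<longleftrightarrow> f differentiable_on UNIV \<and>
     (\<forall>b\<in>Basis. Ck k (\<lambda>p. frechet_derivative f (at p) b))"

text \<open>\<open>C\<^sub>0\<^sup>\<infinity>(U)\<close> for open \<open>U\<close>; its members are extended by zero to the whole space.\<close>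

definition test_function :: "'a::euclidean_space set \<Rightarrow> ('a \<Rightarrow> real) \<Rightarrow> bool" where
  "test_function U \<phi> \<longleftrightarrow>
     (\<forall>k. Ck k \<phi>) \<and> compact (closure {p. \<phi> p \<noteq> 0}) \<and> closure {p. \<phi> p \<noteq> 0} \<subseteq> U"

definition dt :: "(real \<times> real \<Rightarrow> real) \<Rightarrow> real \<times> real \<Rightarrow> real" where
  "dt \<phi> = (\<lambda>(t, x). deriv (\<lambda>s. \<phi> (s, x)) t)"

definition dx :: "(real \<times> real \<Rightarrow> real) \<Rightarrow> real \<times> real \<Rightarrow> real" where
  "dx \<phi> = (\<lambda>(t, x). deriv (\<lambda>y. \<phi> (t, y)) x)"

section \<open>Function spaces\<close>

text \<open>Functions on \<open>I \<times> \<real>\<close> are functions of the pair \<open>(t, x)\<close>, of which only the restriction to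
  \<open>I \<times> \<real>\<close> matters.\<close>

abbreviation cyl :: "real set \<Rightarrow> (real \<times> real) measure" where
  "cyl I \<equiv> lebesgue_on (I \<times> UNIV)"

definition weak_derivative :: "(real \<Rightarrow> real) \<Rightarrow> (real \<Rightarrow> real) \<Rightarrow> bool" where
  "weak_derivative f g \<longleftrightarrow>
     (\<forall>K. compact K \<longrightarrow> integrable (lebesgue_on K) f \<and> integrable (lebesgue_on K) g) \<and>
     (\<forall>\<phi>. test_function UNIV \<phi> \<longrightarrow>
        (LINT x|lebesgue. f x * deriv \<phi> x) = - (LINT x|lebesgue. g x * \<phi> x))"

text \<open>\<open>v = \<partial>\<^sub>x u\<close> weakly in \<open>x\<close>, at almost every time; \<open>v\<close> is then unique almost everywhere on
  \<open>I \<times> \<real>\<close>.\<close>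

definition weak_dx :: "real set \<Rightarrow> (real \<times> real \<Rightarrow> real) \<Rightarrow> (real \<times> real \<Rightarrow> real) \<Rightarrow> bool" where
  "weak_dx I u v \<longleftrightarrow> v \<in> borel_measurable (cyl I) \<and>
     (AE t in lebesgue_on I. weak_derivative (\<lambda>x. u (t, x)) (\<lambda>x. v (t, x)))"

text \<open>In the vector-valued Lebesgue spaces below, measurability means joint measurability in
  \<open>(t, x)\<close>. Strong (Bochner) measurability into \<open>L\<^sub>\<infinity>\<close> would be the wrong requirement in
  \<open>L\<^sub>2(I, L\<^sub>\<infinity>\<^sub>,\<^sub>l\<^sub>o\<^sub>c)\<close>: already the translates of a single jump fail it.\<close>

definition Linf_L2loc :: "real set \<Rightarrow> (real \<times> real \<Rightarrow> real) \<Rightarrow> bool" where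
  "Linf_L2loc I u \<longleftrightarrow> u \<in> borel_measurable (cyl I) \<and>
     (\<forall>K. compact K \<longrightarrow>
        esssup (lebesgue_on I) (\<lambda>t. \<integral>\<^sup>+ x. ennreal ((u (t, x))\<^sup>2) \<partial>lebesgue_on K) < \<infinity>)"

definition L2_Linfloc :: "real set \<Rightarrow> (real \<times> real \<Rightarrow> real) \<Rightarrow> bool" where
  "L2_Linfloc I u \<longleftrightarrow> u \<in> borel_measurable (cyl I) \<and>
     (\<forall>K. compact K \<longrightarrow>
        (\<integral>\<^sup>+ t. (esssup (lebesgue_on K) (\<lambda>x. ennreal \<bar>u (t, x)\<bar>))\<^sup>2 \<partial>lebesgue_on I) < \<infinity>)"

definition L2_W12loc :: "real set \<Rightarrow> (real \<times> real \<Rightarrow> real) \<Rightarrow> bool" where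
  "L2_W12loc I u \<longleftrightarrow> u \<in> borel_measurable (cyl I) \<and>
     (\<exists>v. weak_dx I u v \<and>
       (\<forall>K. compact K \<longrightarrow>
          (\<integral>\<^sup>+ t. (\<integral>\<^sup>+ x. ennreal ((u (t, x))\<^sup>2 + (v (t, x))\<^sup>2) \<partial>lebesgue_on K)
             \<partial>lebesgue_on I) < \<infinity>))"

definition Linf :: "real set \<Rightarrow> (real \<times> real \<Rightarrow> real) \<Rightarrow> bool" where
  "Linf I u \<longleftrightarrow> u \<in> borel_measurable (cyl I) \<and> esssup (cyl I) (\<lambda>p. ennreal \<bar>u p\<bar>) < \<infinity>"

section \<open>Weak solutions\<close>

text \<open>The functions \<open>sx\<close>, \<open>h4x\<close>, \<open>h3x\<close>, \<open>gx\<close> represent the weak derivatives \<open>\<partial>\<^sub>x \<sigma>(\<gamma>)\<close>,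
  \<open>\<partial>\<^sub>x h\<^sup>4\<close>, \<open>\<partial>\<^sub>x h\<^sup>3\<close>, \<open>\<partial>\<^sub>x \<gamma>\<close>. Their existence follows from the regularity conditions. For \<open>G = 0\<close>
  (\<open>D = 0\<close>) the derivatives multiplied by \<open>G\<close> (by \<open>D\<close>) need not exist, and the corresponding terms
  vanish. \<open>has_bochner_integral\<close> includes integrability of the integrand, so that no integral
  vanishes by the convention for nonintegrable functions.\<close>

definition weak_solution_bounded ::
  "real \<Rightarrow> real \<Rightarrow> (real \<Rightarrow> real) \<Rightarrow> real set \<Rightarrow> (real \<times> real \<Rightarrow> real) \<Rightarrow> (real \<times> real \<Rightarrow> real) \<Rightarrow> bool"
  where
  "weak_solution_bounded D G \<sigma> I h \<gamma> \<longleftrightarrow>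
     Linf_L2loc I h \<and> L2_Linfloc I h \<and> L2_W12loc I (\<lambda>p. G * h p powr (5/2)) \<and>
     (AE p in cyl I. 0 \<le> h p) \<and>
     Linf I \<gamma> \<and> L2_W12loc I (\<lambda>p. D * \<gamma> p) \<and>
     (AE p in cyl I. 0 \<le> \<gamma> p \<and> \<gamma> p < 1) \<and>
     L2_W12loc I (\<lambda>p. \<sigma> (\<gamma> p)) \<and>
     (\<exists>sx h4x h3x gx.
        weak_dx I (\<lambda>p. \<sigma> (\<gamma> p)) sx \<and>
        (G \<noteq> 0 \<longrightarrow> weak_dx I (\<lambda>p. h p ^ 4) h4x \<and> weak_dx I (\<lambda>p. h p ^ 3) h3x) \<and>
        (D \<noteq> 0 \<longrightarrow> weak_dx I \<gamma> gx) \<and>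
        (\<forall>\<phi>. test_function (I \<times> UNIV) \<phi> \<longrightarrow>
           has_bochner_integral (cyl I)
             (\<lambda>p. h p * dt \<phi> p + (h p)\<^sup>2 / 2 * sx p * dx \<phi> p - G / 12 * h4x p * dx \<phi> p) 0 \<and>
           has_bochner_integral (cyl I)
             (\<lambda>p. \<gamma> p * dt \<phi> p + h p * \<gamma> p * sx p * dx \<phi> p - D * gx p * dx \<phi> p
                - G / 6 * \<gamma> p * h3x p * dx \<phi> p) 0))"

definition weak_solution ::
  "real \<Rightarrow> real \<Rightarrow> (real \<Rightarrow> real) \<Rightarrow> real set \<Rightarrow> (real \<times> real \<Rightarrow> real) \<Rightarrow> (real \<times> real \<Rightarrow> real) \<Rightarrow> bool"
  where
  "weak_solution D G \<sigma> I h \<gamma> \<longleftrightarrow> open I \<and> is_interval I \<and>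
     (if bounded I then weak_solution_bounded D G \<sigma> I h \<gamma>
      else \<forall>J. J \<subseteq> I \<and> open J \<and> is_interval J \<and> bounded J \<longrightarrow> weak_solution_bounded D G \<sigma> J h \<gamma>)"

definition rho :: "(real \<Rightarrow> real) \<Rightarrow> real \<Rightarrow> real" where
  "rho \<sigma>' z = (if z = 1 then 0 else - 1 / \<sigma>' z)"

end

theory Submission
  imports Defs
begin

text \<open>Integrating the travelling wave system once gives, with \<open>h = Hs\<close> and \<open>s = (\<sigma> \<circ> \<Gamma>)'\<close>,
  \<open>H\<^sup>2/2 s - G/3 H\<^sup>3 H' = H - h\<close> and \<open>H \<Gamma> s - D \<Gamma>' - G/2 \<Gamma> H\<^sup>2 H' = \<Gamma>\<close>.
  For \<open>D = 0\<close> these equations are solved explicitly: behind the front \<open>\<xi> = 0\<close> one has \<open>H = 2h\<close> and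
  \<open>\<sigma>(\<Gamma>)\<close> affine, ahead of it \<open>\<Gamma> = 0\<close> and \<open>H\<close> jumps to \<open>h\<close> or relaxes to \<open>h\<close> by the scalar equation
  \<open>G H\<^sup>3 H' = -3 (H - h)\<close>.
  For \<open>D > 0\<close> the height is written as a function \<open>H = \<eta>(\<Gamma>)\<close>, and \<open>\<Gamma>\<close> solves a scalar autonomous equation
  \<open>\<Gamma>' = - v(\<Gamma>)\<close>. If \<open>G = 0\<close>, then \<open>\<eta>\<close> is the root of a quadratic equation. If \<open>G > 0\<close>, then
  \<open>d\<eta>/d\<Gamma> = (6/G) (D a(\<eta>)/\<Gamma> + \<sigma>'(\<Gamma>) b(\<eta>))\<close> with \<open>a\<close> increasing, \<open>b\<close> decreasing on \<open>[h, 2h]\<close>, \<open>a(h) = 0\<close> and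
  \<open>b(2h) = 0\<close>. In the variable \<open>\<tau>\<close> with \<open>d\<tau>/d\<Gamma> = -C (D/\<Gamma> - \<sigma>'(\<Gamma>))\<close>, which runs over the whole line, this
  becomes \<open>d\<eta>/d\<tau> = - \<kappa> (w a(\<eta>) - (1 - w) b(\<eta>))\<close> with a weight \<open>w\<close> tending to \<open>0\<close> and \<open>1\<close> at \<open>\<mp>\<infinity>\<close>; by the monotonicity of
  \<open>a\<close> and \<open>b\<close> the solution with the required limits is the fixed point of a contraction.\<close>

section \<open>Test functions and weak derivatives\<close>

lemma differentiable_of_Ck:
  assumes "Ck (Suc k) \<phi>"
  shows "\<phi> differentiable (at p)"
  using assms by (simp add: differentiable_on_def)

lemma test_function_support:
  assumes "test_function U \<phi>"
  obtains r where "0 < r" "\<And>p. r \<le> norm p \<Longrightarrow> p \<notin> closure {p. \<phi> p \<noteq> 0}"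
proof -
  have "bounded (closure {p. \<phi> p \<noteq> 0})"
    using assms by (simp add: test_function_def compact_imp_bounded)
  then obtain b where "0 < b" "\<And>p. p \<in> closure {p. \<phi> p \<noteq> 0} \<Longrightarrow> norm p \<le> b"
    by (auto simp: bounded_pos)
  then show thesis
    \<comment> \<open>The extra 1 makes the bound strict: the support has norm at most
      \<open>b\<close>, so no point of norm at least \<open>b + 1\<close> belongs to it.\<close>
    by (intro that[of "b + 1"]) force+
qed

lemma has_derivative_0_off_support:
  fixes \<phi> :: "'a::euclidean_space \<Rightarrow> real"
  assumes "p \<notin> closure {p. \<phi> p \<noteq> 0}"
  shows "(\<phi> has_derivative (\<lambda>_. 0)) (at p)"
proof (rule has_derivative_transform_within_open)
  show "((\<lambda>_. 0) has_derivative (\<lambda>_. 0)) (at p)" by simp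
  show "open (- closure {p. \<phi> p \<noteq> 0})" "p \<in> - closure {p. \<phi> p \<noteq> 0}" using assms by auto
  show "0 = \<phi> x" if "x \<in> - closure {p. \<phi> p \<noteq> 0}" for x
    using that closure_subset[of "{p. \<phi> p \<noteq> 0}"] by auto
qed

text \<open>\<open>Ck\<close> is phrased with Frechet derivatives, \<open>weak_derivative\<close>
  with \<open>deriv\<close>. On the line the two agree after evaluation at the basis vector
  1.\<close>

lemma test_function_deriv_real:
  fixes \<phi> :: "real \<Rightarrow> real"
  assumes "test_function U \<phi>"
  shows "(\<phi> has_real_derivative deriv \<phi> x) (at x)" "continuous_on UNIV (deriv \<phi>)"
    "x \<notin> closure {p. \<phi> p \<noteq> 0} \<Longrightarrow> deriv \<phi> x = 0"
proof -
  have C: "Ck (Suc (Suc 0)) \<phi>" "Ck (Suc 0) \<phi>"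
    using assms unfolding test_function_def by blast+
  have d: "(\<phi> has_real_derivative deriv \<phi> x) (at x)" for x
    using differentiable_of_Ck[OF C(2)] by (simp add: DERIV_deriv_iff_real_differentiable)
  then show "(\<phi> has_real_derivative deriv \<phi> x) (at x)" .
  have "frechet_derivative \<phi> (at x) 1 = deriv \<phi> x" for x
    using frechet_derivative_at[OF d[of x, unfolded has_field_derivative_def]] by (metis mult.right_neutral)
  then show "continuous_on UNIV (deriv \<phi>)"
    using C(2) by simp
  show "deriv \<phi> x = 0" if "x \<notin> closure {p. \<phi> p \<noteq> 0}"
    using has_derivative_0_off_support[OF that]
    by (intro DERIV_imp_deriv) (simp add: has_field_derivative_def lambda_zero)
qed

text \<open>By linearity the Frechet derivative is determined by its values at (1, 0) and (0, 1),
  and restriction to the coordinate lines identifies these with \<open>dt\<close> and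
  \<open>dx\<close>. The total derivative is recorded because the travelling wave argument
  differentiates along the diagonal direction (1, 1).\<close>

lemma test_function_deriv_pair:
  fixes \<phi> :: "real \<times> real \<Rightarrow> real"
  assumes "test_function U \<phi>"
  shows "(\<phi> has_derivative (\<lambda>(a, b). a * dt \<phi> p + b * dx \<phi> p)) (at p)"
    "continuous_on UNIV (dt \<phi>)" "continuous_on UNIV (dx \<phi>)"
    "p \<notin> closure {p. \<phi> p \<noteq> 0} \<Longrightarrow> dt \<phi> p = 0 \<and> dx \<phi> p = 0"
proof -
  have C: "Ck (Suc 0) \<phi>"
    using assms unfolding test_function_def by blast
  define F where "F p = frechet_derivative \<phi> (at p)" for p
  have F: "(\<phi> has_derivative F p) (at p)" for p
    using differentiable_of_Ck[OF C, of p] unfolding F_def by (simp add: frechet_derivative_works)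
  have lin: "linear (F p)" for p
    using F has_derivative_linear by blast
  have t: "dt \<phi> p = F p (1, 0)" for p
  proof -
    obtain t x where p: "p = (t, x)" by (cases p)
    have "((\<lambda>s. (s, x)) has_derivative (\<lambda>a. (a, 0))) (at t)"
      by (intro has_derivative_Pair has_derivative_ident has_derivative_const)
    from has_derivative_compose[OF this F]
    have "((\<lambda>s. \<phi> (s, x)) has_derivative (\<lambda>a. F p (a, 0))) (at t)"
      by (simp add: p)
    moreover have "(\<lambda>a. F p (a, 0)) = (*) (F p (1, 0))"
    proof
      show "F p (a, 0) = F p (1, 0) * a" for a
        using linear_cmul[OF lin, of p a "(1, 0)"] by simp
    qed
    ultimately have "((\<lambda>s. \<phi> (s, x)) has_real_derivative F p (1, 0)) (at t)"
      unfolding has_field_derivative_def by metis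
    then show ?thesis by (simp add: dt_def p DERIV_imp_deriv)
  qed
  have x: "dx \<phi> p = F p (0, 1)" for p
  proof -
    obtain t x where p: "p = (t, x)" by (cases p)
    have "((\<lambda>s. (t, s)) has_derivative (\<lambda>a. (0, a))) (at x)"
      by (intro has_derivative_Pair has_derivative_ident has_derivative_const)
    from has_derivative_compose[OF this F]
    have "((\<lambda>s. \<phi> (t, s)) has_derivative (\<lambda>a. F p (0, a))) (at x)"
      by (simp add: p)
    moreover have "(\<lambda>a. F p (0, a)) = (*) (F p (0, 1))"
    proof
      show "F p (0, a) = F p (0, 1) * a" for a
        using linear_cmul[OF lin, of p a "(0, 1)"] by simp
    qed
    ultimately have "((\<lambda>s. \<phi> (t, s)) has_real_derivative F p (0, 1)) (at x)"
      unfolding has_field_derivative_def by metis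
    then show ?thesis by (simp add: dx_def p DERIV_imp_deriv)
  qed
  have "F p (a, b) = a * dt \<phi> p + b * dx \<phi> p" for a b
    using linear_add[OF lin, of p "(a, 0)" "(0, b)"] linear_cmul[OF lin, of p a "(1, 0)"]
      linear_cmul[OF lin, of p b "(0, 1)"] by (simp add: t x)
  then have "F p = (\<lambda>(a, b). a * dt \<phi> p + b * dx \<phi> p)"
    by auto
  then show "(\<phi> has_derivative (\<lambda>(a, b). a * dt \<phi> p + b * dx \<phi> p)) (at p)"
    using F[of p] by simp
  have "dt \<phi> = (\<lambda>p. F p (1, 0))" "dx \<phi> = (\<lambda>p. F p (0, 1))" using t x by auto
  then show "continuous_on UNIV (dt \<phi>)" "continuous_on UNIV (dx \<phi>)"
    using C unfolding F_def by (simp_all add: Basis_prod_def)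
  show "dt \<phi> p = 0 \<and> dx \<phi> p = 0" if "p \<notin> closure {p. \<phi> p \<noteq> 0}"
  proof -
    have "F p = (\<lambda>_. 0)"
      using has_derivative_unique[OF F has_derivative_0_off_support[OF that]] .
    then show ?thesis using t x by simp
  qed
qed

text \<open>Without diffusion the profiles have a kink at the front \<open>\<xi> = 0\<close>; the value of \<open>f'\<close> there is
  arbitrary.\<close>

definition smooth_off_0 :: "(real \<Rightarrow> real) \<Rightarrow> (real \<Rightarrow> real) \<Rightarrow> bool" where
  "smooth_off_0 f f' \<longleftrightarrow> continuous_on UNIV f \<and> f' \<in> borel_measurable borel \<and>
     (\<forall>r. bounded (f' ` {-r..r})) \<and> (\<forall>x. x \<noteq> 0 \<longrightarrow> (f has_real_derivative f' x) (at x))"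

section \<open>Translated profiles in the local function spaces\<close>

lemma bounded_image_shift:
  fixes f :: "real \<Rightarrow> real"
  assumes "\<And>r. bounded (f ` {-r..r})" "bounded K"
  shows "bounded ((\<lambda>x. f (x - t)) ` K)"
proof -
  obtain r where "\<And>x. x \<in> K \<Longrightarrow> \<bar>x\<bar> \<le> r" using assms(2) by (auto simp: bounded_iff)
  then have "(\<lambda>x. f (x - t)) ` K \<subseteq> f ` {-(r + \<bar>t\<bar>)..r + \<bar>t\<bar>}"
    by (force intro!: imageI)
  then show ?thesis using assms(1) bounded_subset by blast
qed

lemma smooth_off_0_bounded:
  assumes "smooth_off_0 f f'"
  shows "bounded (f ` {-r..r})" "bounded (f' ` {-r..r})"
  using assms unfolding smooth_off_0_def
  by (auto intro!: compact_imp_bounded compact_continuous_image intro: continuous_on_subset)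

lemma smooth_off_0_measurable:
  assumes "smooth_off_0 f f'"
  shows "f \<in> borel_measurable borel" "f' \<in> borel_measurable borel"
  using assms unfolding smooth_off_0_def by (auto intro: borel_measurable_continuous_onI)

lemma integrable_on_compact:
  fixes f :: "real \<Rightarrow> real"
  assumes "f \<in> borel_measurable borel" "bounded (f ` K)" "compact K"
  shows "integrable (lebesgue_on K) f"
proof -
  obtain B where "\<forall>x\<in>K. \<bar>f x\<bar> \<le> B" using assms(2) by (auto simp: bounded_iff)
  moreover have "K \<in> lmeasurable" using assms(3) lmeasurable_compact by blast
  moreover have "f \<in> borel_measurable (lebesgue_on K)"
    using assms(1) by (simp add: measurable_completion measurable_restrict_space1)
  ultimately show ?thesis
    by (intro integrableI_bounded_set[where A=K and B=B])
      (auto simp: emeasure_restrict_space fmeasurable_def sets_restrict_space_iff intro!: AE_I2)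
qed

text \<open>Integration by parts: the product of the translated profile with \<phi> is continuous,
  differentiable except at one point, and vanishes at the ends of an interval containing the support
  of \<phi>. A version of the fundamental theorem that tolerates exceptional points applies.\<close>

lemma weak_derivative_shift:
  assumes "smooth_off_0 f f'"
  shows "weak_derivative (\<lambda>x. f (x - t)) (\<lambda>x. f' (x - t))"
  unfolding weak_derivative_def
proof (intro conjI allI impI)
  have [measurable]: "f \<in> borel_measurable borel" "f' \<in> borel_measurable borel"
    using smooth_off_0_measurable[OF assms] by auto
  have b: "bounded ((\<lambda>x. f (x - t)) ` K)" "bounded ((\<lambda>x. f' (x - t)) ` K)" if "compact K" for K
    using bounded_image_shift smooth_off_0_bounded[OF assms] compact_imp_bounded that by blast+
  show "integrable (lebesgue_on K) (\<lambda>x. f (x - t))" "integrable (lebesgue_on K) (\<lambda>x. f' (x - t))"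
    if "compact K" for K
    using that b by (auto intro!: integrable_on_compact)
  fix \<phi> :: "real \<Rightarrow> real" assume \<phi>: "test_function UNIV \<phi>"
  note d = test_function_deriv_real[OF \<phi>]
  obtain r where r: "0 < r" "\<And>p. r \<le> norm p \<Longrightarrow> p \<notin> closure {p. \<phi> p \<noteq> 0}"
    using test_function_support[OF \<phi>] by blast
  have z: "\<phi> x = 0" "deriv \<phi> x = 0" if "r \<le> \<bar>x\<bar>" for x
    using d(3)[of x] r(2)[of x] that closure_subset[of "{p. \<phi> p \<noteq> 0}"] by auto
  have c\<phi>: "continuous_on UNIV \<phi>"
    using d(1) by (meson DERIV_isCont continuous_at_imp_continuous_on)
  have [measurable]: "\<phi> \<in> borel_measurable borel" "deriv \<phi> \<in> borel_measurable borel"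
    using c\<phi> d(2) by (auto intro: borel_measurable_continuous_onI)
  let ?K = "{-r..r}"
  have bb: "bounded (\<phi> ` ?K)" "bounded (deriv \<phi> ` ?K)"
    using c\<phi> d(2) by (auto intro!: compact_imp_bounded compact_continuous_image intro: continuous_on_subset)
  have bm: "bounded ((\<lambda>x. u x * v x) ` ?K)" if uv: "bounded (u ` ?K)" "bounded (v ` ?K)" for u v :: "real \<Rightarrow> real"
  proof -
    obtain B C where "\<forall>x\<in>?K. \<bar>u x\<bar> \<le> B" "\<forall>x\<in>?K. \<bar>v x\<bar> \<le> C"
      using uv unfolding bounded_iff by auto
    then have "\<forall>x\<in>?K. \<bar>u x * v x\<bar> \<le> B * C"
      unfolding abs_mult by (meson abs_ge_zero mult_mono order_trans)
    then show ?thesis unfolding bounded_iff by auto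
  qed
  have "integrable (lebesgue_on ?K) (\<lambda>x. f (x - t) * deriv \<phi> x)"
    "integrable (lebesgue_on ?K) (\<lambda>x. f' (x - t) * \<phi> x)"
    by (intro integrable_on_compact bm b bb compact_Icc; measurable)+
  then have i1: "set_integrable lebesgue ?K (\<lambda>x. f (x - t) * deriv \<phi> x)"
    and i2: "set_integrable lebesgue ?K (\<lambda>x. f' (x - t) * \<phi> x)"
    by (simp_all add: integrable_restrict_space set_integrable_def)
  \<comment> \<open>The possible kink of \<open>f\<close> at 0 sits at \<open>x = t\<close> after
    the translation, so \<open>{t}\<close> is the exceptional set.\<close>
  have "((\<lambda>x. f (x - t) * deriv \<phi> x + f' (x - t) * \<phi> x) has_integral f (r - t) * \<phi> r - f (-r - t) * \<phi> (-r)) ?K"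
  proof (rule fundamental_theorem_of_calculus_interior_strong[where S="{t}"])
    show "continuous_on ?K (\<lambda>x. f (x - t) * \<phi> x)"
      using assms c\<phi> unfolding smooth_off_0_def
      by (auto intro!: continuous_intros intro: continuous_on_subset continuous_on_compose2[of UNIV f])
    fix x assume "x \<in> {-r<..<r} - {t}"
    then have "(f has_real_derivative f' (x - t)) (at (x - t))"
      using assms unfolding smooth_off_0_def by auto
    then have "((\<lambda>x. f (x - t)) has_real_derivative f' (x - t)) (at x)"
      using DERIV_shift[of f "f' (x - t)" x "-t"] by simp
    from DERIV_mult[OF this d(1)[of x]]
    show "((\<lambda>x. f (x - t) * \<phi> x) has_vector_derivative f (x - t) * deriv \<phi> x + f' (x - t) * \<phi> x) (at x)"
      by (simp add: has_real_derivative_iff_has_vector_derivative algebra_simps)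
  qed (use r in auto)
  then have "integral ?K (\<lambda>x. f (x - t) * deriv \<phi> x + f' (x - t) * \<phi> x) = 0"
    using z[of r] z[of "-r"] r(1) by (auto simp: integral_unique)
  then have s: "(LINT x:?K|lebesgue. f (x - t) * deriv \<phi> x) + (LINT x:?K|lebesgue. f' (x - t) * \<phi> x) = 0"
    using set_lebesgue_integral_eq_integral(2)[OF set_integral_add(1)[OF i1 i2]] set_integral_add(2)[OF i1 i2] by simp
  \<comment> \<open>Outside \<open>?K\<close> both \<phi> and its derivative vanish, so cutting off
    to \<open>?K\<close> does not change the integrals over the line.\<close>
  have "indicator ?K x *\<^sub>R (f (x - t) * deriv \<phi> x) = f (x - t) * deriv \<phi> x"
    "indicator ?K x *\<^sub>R (f' (x - t) * \<phi> x) = f' (x - t) * \<phi> x" for x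
    using z[of x] by (cases "r \<le> \<bar>x\<bar>"; auto simp: indicator_def)+
  with s show "(LINT x|lebesgue. f (x - t) * deriv \<phi> x) = - (LINT x|lebesgue. f' (x - t) * \<phi> x)"
    unfolding set_lebesgue_integral_def by (simp only:)
qed

lemma measurable_travelling:
  fixes U :: "real \<Rightarrow> real"
  assumes [measurable]: "U \<in> borel_measurable borel"
  shows "(\<lambda>(t, x). U (x - t)) \<in> borel_measurable (cyl I)"
proof -
  have "(\<lambda>(t, x). U (x - t)) \<in> borel_measurable (borel \<Otimes>\<^sub>M borel)" by measurable
  then show ?thesis
    by (simp add: borel_prod measurable_completion measurable_restrict_space1)
qed

lemma weak_dx_travelling:
  assumes "smooth_off_0 U V"
  shows "weak_dx I (\<lambda>(t, x). U (x - t)) (\<lambda>(t, x). V (x - t))"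
  unfolding weak_dx_def using weak_derivative_shift[OF assms]
  by (simp add: measurable_travelling[OF smooth_off_0_measurable(2)[OF assms]])

lemma travelling_bound:
  fixes U :: "real \<Rightarrow> real"
  assumes "\<And>r. bounded (U ` {-r..r})" "bounded I" "bounded K"
  obtains B where "\<And>t x. t \<in> I \<Longrightarrow> x \<in> K \<Longrightarrow> \<bar>U (x - t)\<bar> \<le> B"
proof -
  obtain r where r: "\<And>t. t \<in> I \<Longrightarrow> \<bar>t\<bar> \<le> r" using assms(2) by (auto simp: bounded_iff)
  obtain q where q: "\<And>t. t \<in> K \<Longrightarrow> \<bar>t\<bar> \<le> q" using assms(3) by (auto simp: bounded_iff)
  obtain B where B: "\<forall>y\<in>{-(r+q)..r+q}. \<bar>U y\<bar> \<le> B"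
    using assms(1)[of "r+q"] by (auto simp: bounded_iff)
  have "\<bar>U (x - t)\<bar> \<le> B" if "t \<in> I" "x \<in> K" for t x
    using B[rule_format, of "x - t"] r[OF that(1)] q[OF that(2)] by fastforce
  then show ?thesis by (rule that)
qed

text \<open>The classical derivative off the kink serves as the weak one. On \<open>I\<close> times
  \<open>K\<close> the argument \<open>x - t\<close> stays in a bounded set, so the integrand is
  bounded there, and both factors have finite measure.\<close>

lemma L2_W12loc_travelling:
  assumes UV: "smooth_off_0 U V" and I: "bounded I" "open I"
  shows "L2_W12loc I (\<lambda>(t, x). U (x - t))"
  unfolding L2_W12loc_def
proof (intro conjI exI[of _ "\<lambda>(t, x). V (x - t)"] allI impI)
  show "(\<lambda>(t, x). U (x - t)) \<in> borel_measurable (cyl I)"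
    using measurable_travelling smooth_off_0_measurable(1)[OF UV] .
  show "weak_dx I (\<lambda>(t, x). U (x - t)) (\<lambda>(t, x). V (x - t))"
    using weak_dx_travelling[OF UV] .
  fix K :: "real set" assume K: "compact K"
  obtain A where A: "\<And>t x. t \<in> I \<Longrightarrow> x \<in> K \<Longrightarrow> \<bar>U (x - t)\<bar> \<le> A"
    using travelling_bound[OF smooth_off_0_bounded(1)[OF UV] I(1) compact_imp_bounded[OF K]] by metis
  obtain B where B: "\<And>t x. t \<in> I \<Longrightarrow> x \<in> K \<Longrightarrow> \<bar>V (x - t)\<bar> \<le> B"
    using travelling_bound[OF smooth_off_0_bounded(2)[OF UV] I(1) compact_imp_bounded[OF K]] by metis
  have le: "(U (x - t))\<^sup>2 + (V (x - t))\<^sup>2 \<le> A\<^sup>2 + B\<^sup>2" if "t \<in> I" "x \<in> K" for t x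
    using A[OF that] B[OF that] by (metis abs_ge_zero add_mono power2_abs power_mono)
  have m: "emeasure lebesgue K < \<infinity>" "emeasure lebesgue I < \<infinity>" "K \<in> sets lebesgue" "I \<in> sets lebesgue"
    using K I lmeasurable_compact[of K] lmeasurable_open[of I] by (auto simp: fmeasurable_def)
  have "(\<integral>\<^sup>+ t. (\<integral>\<^sup>+ x. ennreal (((\<lambda>(t, x). U (x - t)) (t, x))\<^sup>2 + ((\<lambda>(t, x). V (x - t)) (t, x))\<^sup>2) \<partial>lebesgue_on K) \<partial>lebesgue_on I)
     \<le> (\<integral>\<^sup>+ t. (\<integral>\<^sup>+ x. ennreal (A\<^sup>2 + B\<^sup>2) \<partial>lebesgue_on K) \<partial>lebesgue_on I)"
    using le by (intro nn_integral_mono) (auto simp del: ennreal_plus intro!: ennreal_leI)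
  also have "\<dots> < \<infinity>"
    using m by (simp add: emeasure_restrict_space ennreal_mult_less_top)
  finally show "(\<integral>\<^sup>+ t. (\<integral>\<^sup>+ x. ennreal (((\<lambda>(t, x). U (x - t)) (t, x))\<^sup>2 + ((\<lambda>(t, x). V (x - t)) (t, x))\<^sup>2) \<partial>lebesgue_on K) \<partial>lebesgue_on I) < \<infinity>" .
qed

section \<open>Weak form of the travelling wave equations\<close>

lemma integrable_bounded_support:
  fixes f :: "'a::euclidean_space \<Rightarrow> real"
  assumes "f \<in> borel_measurable borel" "bounded (range f)" "\<And>x. r \<le> norm x \<Longrightarrow> f x = 0"
  shows "integrable lborel f"
proof -
  obtain B where "\<forall>x. \<bar>f x\<bar> \<le> B" using assms(2) by (auto simp: bounded_iff)
  then show ?thesis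
    using assms(1,3) emeasure_lborel_cball_finite[of "0 :: 'a" r]
    by (intro integrableI_bounded_set[where A="cball 0 r" and B=B]) (auto intro!: AE_I2)
qed

lemma integral_derivative_bounded_support:
  fixes F :: "real \<Rightarrow> real"
  assumes F: "\<And>x. (F has_real_derivative F' x) (at x)" and c: "continuous_on UNIV F'"
    and z: "\<And>x. r \<le> \<bar>x\<bar> \<Longrightarrow> F x = 0 \<and> F' x = 0" and r: "0 < r"
  shows "(LINT x|lborel. F' x) = 0"
proof -
  have "(LBINT x. F' x * indicator {-r..r} x) = F r - F (-r)"
    using r c by (intro integral_FTC_Icc_real) (auto intro!: F simp: continuous_on_eq_continuous_at)
  moreover have "(LBINT x. F' x * indicator {-r..r} x) = (LBINT x. F' x)"
  proof (intro Bochner_Integration.integral_cong refl)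
    show "F' x * indicator {-r..r} x = F' x" for x
      using z[of x] by (cases "r \<le> \<bar>x\<bar>") (auto simp: indicator_def)
  qed
  ultimately show ?thesis
    using z[of r] z[of "-r"] r by simp
qed

text \<open>In the coordinates \<open>(t, y)\<close> with \<open>y = x - t\<close> the derivative \<open>\<partial>\<^sub>t + \<partial>\<^sub>x\<close> becomes \<open>\<partial>\<^sub>t\<close>, whose
  integral against the time-independent function \<open>B\<close> vanishes.\<close>

lemma travelling_integral_identity:
  assumes \<phi>: "test_function (I \<times> UNIV) \<phi>" and I: "open I"
    and B [measurable]: "B \<in> borel_measurable borel" and bB: "bounded (range B)"
    and C: "\<And>\<xi>. C \<xi> = B \<xi> - c"
  shows "has_bochner_integral (cyl I)
    (\<lambda>(t, x). B (x - t) * dt \<phi> (t, x) + C (x - t) * dx \<phi> (t, x)) 0"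
proof -
  note d = test_function_deriv_pair[OF \<phi>]
  obtain r where r: "0 < r" "\<And>p. r \<le> norm p \<Longrightarrow> p \<notin> closure {p. \<phi> p \<noteq> 0}"
    using test_function_support[OF \<phi>] by blast
  \<comment> \<open>This is the derivative of \<phi> in the direction (1, 1), along which functions
    of \<open>x - t\<close> are constant.\<close>
  define \<psi> where "\<psi> p = dt \<phi> p + dx \<phi> p" for p
  have c\<psi>: "continuous_on UNIV \<psi>"
    unfolding \<psi>_def using d(2,3) by (intro continuous_intros)
  have z: "\<phi> p = 0" "\<psi> p = 0" "dt \<phi> p = 0" "dx \<phi> p = 0" if "r \<le> norm p" for p
    using d(4)[of p] r(2)[of p] that closure_subset[of "{p. \<phi> p \<noteq> 0}"] by (auto simp: \<psi>_def)
  have nt: "r \<le> norm (t, x)" if "r \<le> \<bar>t\<bar>" for t x :: real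
    using that norm_fst_le[of t x] by simp
  have nx: "r \<le> norm (t, x)" if "r \<le> \<bar>x\<bar>" for t x :: real
    using that norm_snd_le[of x t] by simp
  have [measurable]: "\<psi> \<in> borel_measurable (borel \<Otimes>\<^sub>M borel)" "dx \<phi> \<in> borel_measurable (borel \<Otimes>\<^sub>M borel)"
    unfolding borel_prod using c\<psi> d(3) by (auto intro: borel_measurable_continuous_onI)
  have bsupp: "bounded (range f)" if f: "continuous_on UNIV f" "\<And>p. r \<le> norm p \<Longrightarrow> f p = 0" for f :: "real \<times> real \<Rightarrow> real"
  proof -
    have "range f \<subseteq> insert 0 (f ` cball 0 r)"
      using f(2) by force
    moreover have "bounded (f ` cball 0 r)"
      using f(1) by (intro compact_imp_bounded compact_continuous_image) (auto intro: continuous_on_subset)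
    ultimately show ?thesis by (meson bounded_insert bounded_subset)
  qed
  have b\<psi>: "bounded (range \<psi>)" and bx: "bounded (range (dx \<phi>))"
    using bsupp c\<psi> d(3) z by auto
  obtain M where M: "\<forall>y. \<bar>B y\<bar> \<le> M" using bB by (auto simp: bounded_iff)
  obtain N where N: "\<forall>p. \<bar>\<psi> p\<bar> \<le> N" using b\<psi> by (auto simp: bounded_iff)
  have MN: "\<bar>B y * \<psi> p\<bar> \<le> M * N" for y p
    unfolding abs_mult using M N by (meson abs_ge_zero mult_mono order_trans)
  \<comment> \<open>\<open>?g\<close> is \<open>?f\<close> in the moving coordinate
    \<open>y = x - t\<close>, a shear that preserves Lebesgue measure.\<close>
  let ?f = "\<lambda>(t, x). B (x - t) * \<psi> (t, x)" and ?g = "\<lambda>(t, y). B y * \<psi> (t, y + t)"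
  have fm: "?f \<in> borel_measurable (borel \<Otimes>\<^sub>M borel)" "?g \<in> borel_measurable (borel \<Otimes>\<^sub>M borel)"
    by measurable
  have if': "integrable (lborel \<Otimes>\<^sub>M lborel) ?f"
    unfolding lborel_prod
    using fm(1) z MN unfolding borel_prod
    by (intro integrable_bounded_support[where r=r]) (auto simp: bounded_iff intro!: exI[of _ "M * N"])
  \<comment> \<open>If \<open>t\<close> and \<open>y + t\<close> both have modulus below
    \<open>r\<close>, then \<open>y\<close> has modulus below \<open>2 * r\<close>, so
    \<open>(t, y)\<close> has norm below \<open>3 * r\<close>. This bounds the sheared
    support.\<close>
  have big: "r \<le> norm (t, y + t)" if "3 * r \<le> norm (t, y)" for t y :: real
  proof (rule ccontr)
    assume *: "\<not> r \<le> norm (t, y + t)"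
    then have "\<bar>t\<bar> < r" "\<bar>y + t\<bar> < r"
      using norm_fst_le[of t "y + t"] norm_snd_le[of "y + t" t] by auto
    moreover have "norm (t, y) \<le> \<bar>t\<bar> + \<bar>y\<bar>"
      using norm_Pair_le[of t y] by simp
    ultimately show False using that by linarith
  qed
  have ig: "integrable (lborel \<Otimes>\<^sub>M lborel) ?g"
    unfolding lborel_prod
    using fm(2) z MN big unfolding borel_prod
    by (intro integrable_bounded_support[where r="3 * r"]) (auto simp: bounded_iff intro!: exI[of _ "M * N"])
  have ix: "integrable (lborel \<Otimes>\<^sub>M lborel) (dx \<phi>)"
    unfolding lborel_prod
    using d(3) bx z by (intro integrable_bounded_support[where r=r]) (auto intro: borel_measurable_continuous_onI)
  have der_t: "(LBINT t. \<psi> (t, y + t)) = 0" for y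
  proof (rule integral_derivative_bounded_support[where r=r and F="\<lambda>t. \<phi> (t, y + t)"])
    fix t
    have "((\<lambda>t. (t, y + t)) has_derivative (\<lambda>a. (a, a))) (at t)"
      by (auto intro!: derivative_eq_intros)
    from has_derivative_compose[OF this d(1)]
    show "((\<lambda>t. \<phi> (t, y + t)) has_real_derivative \<psi> (t, y + t)) (at t)"
      by (simp add: has_field_derivative_def \<psi>_def flip: distrib_left) (simp add: mult_commute_abs)
    show "continuous_on UNIV (\<lambda>t. \<psi> (t, y + t))"
      by (intro continuous_on_compose2[OF c\<psi>] continuous_intros) auto
  qed (use z nt r in auto)
  have der_x: "(LBINT x. dx \<phi> (t, x)) = 0" for t
  proof (rule integral_derivative_bounded_support[where r=r and F="\<lambda>x. \<phi> (t, x)"])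
    fix x :: real
    have "((\<lambda>x. (t, x)) has_derivative (\<lambda>a. (0, a))) (at x)"
      by (auto intro!: derivative_eq_intros)
    from has_derivative_compose[OF this d(1)]
    show "((\<lambda>x. \<phi> (t, x)) has_real_derivative dx \<phi> (t, x)) (at x)"
      by (simp add: has_field_derivative_def mult_commute_abs)
    show "continuous_on UNIV (\<lambda>x. dx \<phi> (t, x))"
      by (intro continuous_on_compose2[OF d(3)] continuous_intros) auto
  qed (use z nx r in auto)
  have "integral\<^sup>L (lborel \<Otimes>\<^sub>M lborel) ?f = (LBINT t. (LBINT x. B (x - t) * \<psi> (t, x)))"
    using lborel_pair.integral_fst'[OF if'] by simp
  also have "\<dots> = (LBINT t. (LBINT y. B y * \<psi> (t, y + t)))"
  proof (rule Bochner_Integration.integral_cong)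
    show "(LBINT x. B (x - t) * \<psi> (t, x)) = (LBINT y. B y * \<psi> (t, y + t))" for t
      using lborel_integral_real_affine[of 1 "\<lambda>x. B (x - t) * \<psi> (t, x)" t] by (simp add: add.commute)
  qed simp
  \<comment> \<open>After exchanging the integrals, \<open>B y\<close> is a constant factor of the
    inner one, which integrates the derivative of \<open>\<phi> (t, y + t)\<close> over all
    times.\<close>
  also have "\<dots> = (LBINT y. (LBINT t. B y * \<psi> (t, y + t)))"
    using lborel_pair.Fubini_integral[OF ig] by simp
  also have "\<dots> = 0"
    by (simp add: der_t)
  finally have f0: "integral\<^sup>L (lborel \<Otimes>\<^sub>M lborel) ?f = 0" .
  have x0: "integral\<^sup>L (lborel \<Otimes>\<^sub>M lborel) (dx \<phi>) = 0"
    using lborel_pair.integral_fst'[OF ix] by (simp add: der_x)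
  \<comment> \<open>The constant of integration \<open>c\<close> meets only
    \<open>dx \<phi>\<close>, whose integral is zero; hence fluxes may be known up to a
    constant.\<close>
  have "has_bochner_integral (lborel \<Otimes>\<^sub>M lborel) (\<lambda>p. ?f p - c * dx \<phi> p) (0 - c * 0)"
    using if' ix f0 x0
    by (intro has_bochner_integral_diff has_bochner_integral_mult_right) (auto simp: has_bochner_integral_iff)
  moreover have "(\<lambda>p. ?f p - c * dx \<phi> p) = (\<lambda>(t, x). B (x - t) * dt \<phi> (t, x) + C (x - t) * dx \<phi> (t, x))"
    by (auto simp: C \<psi>_def algebra_simps)
  ultimately have hb: "has_bochner_integral lborel (\<lambda>(t, x). B (x - t) * dt \<phi> (t, x) + C (x - t) * dx \<phi> (t, x)) 0" (is "has_bochner_integral _ ?h 0")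
    by (simp add: lborel_prod)
  \<comment> \<open>The support of \<phi> lies in the cylinder, so the integral over the plane is
    already the one over \<open>cyl I\<close>.\<close>
  have "(\<lambda>p. indicator (I \<times> UNIV) p *\<^sub>R ?h p) = ?h"
  proof
    show "indicator (I \<times> UNIV) p *\<^sub>R ?h p = ?h p" for p
    proof (cases "p \<in> I \<times> UNIV")
      case False
      then have "p \<notin> closure {p. \<phi> p \<noteq> 0}"
        using \<phi> unfolding test_function_def by blast
      then show ?thesis using d(4) by (auto simp: split_beta)
    qed simp
  qed
  moreover have "has_bochner_integral lebesgue ?h 0"
    using hb by (auto simp: has_bochner_integral_iff integrable_completion integral_completion borel_measurable_integrable)
  moreover have "I \<times> (UNIV :: real set) \<in> sets lebesgue"
    by (rule sets_completionI_sets) (use borel_open[OF open_Times[OF I open_UNIV]] in simp)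
  ultimately show ?thesis
    by (simp only: has_bochner_integral_restrict_space space_completion space_lborel space_borel Int_UNIV_right)
qed

text \<open>The two flux identities are the system integrated once over \<open>{\<xi>..}\<close>, with \<open>s\<close>, \<open>H'\<close>, \<open>\<Gamma>'\<close>
  standing for the derivatives of \<open>\<sigma> \<circ> \<Gamma>\<close>, \<open>H\<close>, \<open>\<Gamma>\<close>.\<close>

lemma weak_solution_travelling:
  fixes H H' \<Gamma> \<Gamma>' s :: "real \<Rightarrow> real"
  assumes h: "0 < h" and H [measurable]: "H \<in> borel_measurable borel" and Hb: "\<And>\<xi>. h \<le> H \<xi> \<and> H \<xi> \<le> 2 * h"
    and anti: "antimono \<Gamma>" and \<Gamma>b: "\<And>\<xi>. 0 \<le> \<Gamma> \<xi> \<and> \<Gamma> \<xi> < 1"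
    and \<sigma>: "smooth_off_0 (\<lambda>\<xi>. \<sigma> (\<Gamma> \<xi>)) s"
    and HH: "G \<noteq> 0 \<Longrightarrow> smooth_off_0 H H'" and \<Gamma>\<Gamma>: "D \<noteq> 0 \<Longrightarrow> smooth_off_0 \<Gamma> \<Gamma>'"
    and flux1: "\<And>\<xi>. (H \<xi>)\<^sup>2 / 2 * s \<xi> - G / 3 * H \<xi> ^ 3 * H' \<xi> = H \<xi> - h"
    and flux2: "\<And>\<xi>. H \<xi> * \<Gamma> \<xi> * s \<xi> - D * \<Gamma>' \<xi> - G / 2 * \<Gamma> \<xi> * (H \<xi>)\<^sup>2 * H' \<xi> = \<Gamma> \<xi>"
  shows "weak_solution D G \<sigma> {0<..} (\<lambda>(t, x). H (x - t)) (\<lambda>(t, x). \<Gamma> (x - t))"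
proof -
  \<comment> \<open>Regularity of \<Gamma> itself is assumed only for \<open>D \<noteq> 0\<close>;
    monotonicity gives measurability in every case.\<close>
  have \<Gamma>m [measurable]: "\<Gamma> \<in> borel_measurable borel"
  proof -
    have "mono (\<lambda>x. - \<Gamma> x)" using anti by (simp add: antimono_def mono_def)
    then have "(\<lambda>x. - (- \<Gamma> x)) \<in> borel_measurable borel"
      by (intro borel_measurable_uminus borel_measurable_mono)
    then show ?thesis by simp
  qed
  have Hpos: "0 < H \<xi>" for \<xi> using h Hb[of \<xi>] by linarith
  have pow: "smooth_off_0 (\<lambda>\<xi>. H \<xi> ^ n) (\<lambda>\<xi>. n * H \<xi> ^ (n - 1) * H' \<xi>)" if "G \<noteq> 0" for n
  proof -
    note HH = HH[OF that]
    have "bounded ((\<lambda>\<xi>. n * H \<xi> ^ (n - 1) * H' \<xi>) ` {-r..r})" for r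
    proof -
      obtain B where B: "\<forall>x\<in>{-r..r}. \<bar>H' x\<bar> \<le> B"
        using smooth_off_0_bounded(2)[OF HH, of r] unfolding bounded_iff by auto
      have "\<bar>n * H x ^ (n - 1) * H' x\<bar> \<le> (n * (2 * h) ^ (n - 1)) * B" if "x \<in> {-r..r}" for x
      proof -
        have "H x ^ (n - 1) \<le> (2 * h) ^ (n - 1)"
          using Hb[of x] Hpos[of x] by (intro power_mono) auto
        then show ?thesis
          unfolding abs_mult using B that Hpos[of x] h by (intro mult_mono) auto
      qed
      then show ?thesis unfolding bounded_iff ball_simps real_norm_def by blast
    qed
    moreover have "((\<lambda>\<xi>. H \<xi> ^ n) has_real_derivative n * H x ^ (n - 1) * H' x) (at x)" if "x \<noteq> 0" for x
      using HH that unfolding smooth_off_0_def by (auto intro!: derivative_eq_intros)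
    ultimately show ?thesis
      using HH unfolding smooth_off_0_def by (auto intro!: continuous_intros)
  qed
  have powr': "smooth_off_0 (\<lambda>\<xi>. G * H \<xi> powr (5/2)) (\<lambda>\<xi>. if G = 0 then 0 else G * (5/2 * H \<xi> powr (3/2) * H' \<xi>))"
  proof (cases "G = 0")
    case True
    then show ?thesis by (auto simp: smooth_off_0_def bounded_iff)
  next
    case False
    note HH = HH[OF False]
    have "bounded ((\<lambda>\<xi>. G * (5/2 * H \<xi> powr (3/2) * H' \<xi>)) ` {-r..r})" for r
    proof -
      obtain B where B: "\<forall>x\<in>{-r..r}. \<bar>H' x\<bar> \<le> B"
        using smooth_off_0_bounded(2)[OF HH, of r] unfolding bounded_iff by auto
      have "\<bar>G * (5/2 * H x powr (3/2) * H' x)\<bar> \<le> \<bar>G\<bar> * (5/2 * (2 * h) powr (3/2) * B)" if "x \<in> {-r..r}" for x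
      proof -
        have "H x powr (3/2) \<le> (2 * h) powr (3/2)"
          using Hb[of x] Hpos[of x] by (intro powr_mono2) auto
        then show ?thesis
          unfolding abs_mult using B that Hpos[of x] h by (intro mult_mono) auto
      qed
      then show ?thesis unfolding bounded_iff ball_simps real_norm_def by blast
    qed
    moreover have "((\<lambda>\<xi>. G * H \<xi> powr (5/2)) has_real_derivative G * (5/2 * H x powr (3/2) * H' x)) (at x)" if "x \<noteq> 0" for x
    proof -
      have "(H has_real_derivative H' x) (at x)" using HH that unfolding smooth_off_0_def by auto
      from DERIV_cmult[OF DERIV_chain2[OF has_real_derivative_powr[OF Hpos, of "5/2" x] this], of G]
      show ?thesis by simp
    qed
    moreover have "H' \<in> borel_measurable borel" using HH unfolding smooth_off_0_def by blast
    ultimately show ?thesis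
      using HH Hpos False unfolding smooth_off_0_def
      by (auto intro!: continuous_intros simp: less_imp_neq[symmetric])
  qed
  have Dg: "smooth_off_0 (\<lambda>\<xi>. D * \<Gamma> \<xi>) (\<lambda>\<xi>. if D = 0 then 0 else D * \<Gamma>' \<xi>)"
  proof (cases "D = 0")
    case True
    then show ?thesis by (auto simp: smooth_off_0_def bounded_iff)
  next
    case False
    have "bounded ((\<lambda>x. D * \<Gamma>' x) ` {-r..r})" for r
      using bounded_scaling[OF smooth_off_0_bounded(2)[OF \<Gamma>\<Gamma>[OF False], of r], of D] by (simp add: image_image)
    with False \<Gamma>\<Gamma>[OF False] show ?thesis
      unfolding smooth_off_0_def by (auto intro!: continuous_intros DERIV_cmult)
  qed
  have Hbd: "bounded (H ` S)" and \<Gamma>bd: "bounded (\<Gamma> ` S)" for S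
  proof -
    show "bounded (H ` S)" unfolding bounded_iff using Hb Hpos by (intro exI[of _ "2 * h"]) (auto simp: abs_of_pos)
    show "bounded (\<Gamma> ` S)" unfolding bounded_iff using \<Gamma>b by (intro exI[of _ 1]) (auto intro: less_imp_le)
  qed
  have "weak_solution_bounded D G \<sigma> J (\<lambda>(t, x). H (x - t)) (\<lambda>(t, x). \<Gamma> (x - t))"
    if J: "open J" "bounded J" for J
    unfolding weak_solution_bounded_def
  proof (intro conjI)
    let ?h = "\<lambda>(t, x). H (x - t)" and ?\<gamma> = "\<lambda>(t, x). \<Gamma> (x - t)"
    have J': "emeasure lebesgue J < \<infinity>" "J \<in> sets lebesgue"
      using J lmeasurable_open[of J] by (auto simp: fmeasurable_def)
    have hm: "?h \<in> borel_measurable (cyl J)" and \<gamma>m: "?\<gamma> \<in> borel_measurable (cyl J)"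
      using measurable_travelling H \<Gamma>m by blast+
    show "Linf_L2loc J ?h"
      unfolding Linf_L2loc_def
    proof (intro conjI hm allI impI)
      fix K :: "real set" assume K: "compact K"
      have K': "emeasure lebesgue K < \<infinity>" "K \<in> sets lebesgue" "K \<in> sets borel"
        using K lmeasurable_compact[of K] by (auto simp: fmeasurable_def borel_compact)
      let ?n = "\<lambda>t. \<integral>\<^sup>+ x. ennreal ((?h (t, x))\<^sup>2) \<partial>lebesgue_on K"
      have "?n t \<le> ennreal ((2 * h)\<^sup>2) * emeasure lebesgue K" for t
      proof -
        have "?n t \<le> (\<integral>\<^sup>+ x. ennreal ((2 * h)\<^sup>2) \<partial>lebesgue_on K)"
        proof (intro nn_integral_mono ennreal_leI)
          show "(?h (t, x))\<^sup>2 \<le> (2 * h)\<^sup>2" for x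
            using Hb[of "x - t"] Hpos[of "x - t"] by (simp only: split) (intro power_mono; simp)
        qed
        then show ?thesis using K' by (simp add: emeasure_restrict_space)
      qed
      \<comment> \<open>The bound on \<open>esssup\<close> requires measurability in time. A compact
        \<open>K\<close> is Borel, so the inner integral can be taken with respect to
        \<open>lborel\<close>, where integrals with a parameter are measurable.\<close>
      moreover have "?n \<in> borel_measurable (lebesgue_on J)"
      proof -
        have "?n t = (\<integral>\<^sup>+ x. ennreal ((H (x - t))\<^sup>2) * indicator K x \<partial>lborel)" for t
        proof -
          have "?n t = (\<integral>\<^sup>+ x. ennreal ((H (x - t))\<^sup>2) * indicator K x \<partial>lebesgue)"
            using K' by (simp add: nn_integral_restrict_space)
          also have "\<dots> = (\<integral>\<^sup>+ x. ennreal ((H (x - t))\<^sup>2) * indicator K x \<partial>lborel)"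
            using K' by (intro nn_integral_completion)
          finally show ?thesis .
        qed
        moreover have "(\<lambda>t. \<integral>\<^sup>+ x. ennreal ((H (x - t))\<^sup>2) * indicator K x \<partial>lborel) \<in> borel_measurable borel"
          using K'(3) by measurable
        ultimately show ?thesis
          by (simp add: measurable_completion measurable_restrict_space1)
      qed
      ultimately have "esssup (lebesgue_on J) ?n \<le> ennreal ((2 * h)\<^sup>2) * emeasure lebesgue K"
        by (intro esssup_I AE_I2)
      also have "\<dots> < \<infinity>" using K' by (simp add: ennreal_mult_less_top)
      finally show "esssup (lebesgue_on J) ?n < \<infinity>" .
    qed
    show "L2_Linfloc J ?h"
      unfolding L2_Linfloc_def
    proof (intro conjI hm allI impI)
      fix K :: "real set" assume K: "compact K"
      have "esssup (lebesgue_on K) (\<lambda>x. ennreal \<bar>?h (t, x)\<bar>) \<le> ennreal (2 * h)" for t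
      proof (intro esssup_I AE_I2)
        show "(\<lambda>x. ennreal \<bar>?h (t, x)\<bar>) \<in> borel_measurable (lebesgue_on K)"
          by (simp add: measurable_completion measurable_restrict_space1)
        show "ennreal \<bar>?h (t, x)\<bar> \<le> ennreal (2 * h)" for x
          using Hb[of "x - t"] Hpos[of "x - t"] by (auto intro!: ennreal_leI)
      qed
      then have "(\<integral>\<^sup>+ t. (esssup (lebesgue_on K) (\<lambda>x. ennreal \<bar>?h (t, x)\<bar>))\<^sup>2 \<partial>lebesgue_on J)
          \<le> (\<integral>\<^sup>+ t. (ennreal (2 * h))\<^sup>2 \<partial>lebesgue_on J)"
        by (intro nn_integral_mono power_mono) auto
      also have "\<dots> < \<infinity>"
        using J' by (simp add: emeasure_restrict_space ennreal_mult_less_top power2_eq_square)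
      finally show "(\<integral>\<^sup>+ t. (esssup (lebesgue_on K) (\<lambda>x. ennreal \<bar>?h (t, x)\<bar>))\<^sup>2 \<partial>lebesgue_on J) < \<infinity>" .
    qed
    show "L2_W12loc J (\<lambda>p. G * ?h p powr (5/2))"
      using L2_W12loc_travelling[OF powr' J(2,1)] by (simp add: case_prod_beta')
    show "L2_W12loc J (\<lambda>p. D * ?\<gamma> p)"
      using L2_W12loc_travelling[OF Dg J(2,1)] by (simp add: case_prod_beta')
    show "L2_W12loc J (\<lambda>p. \<sigma> (?\<gamma> p))"
      using L2_W12loc_travelling[OF \<sigma> J(2,1)] by (simp add: case_prod_beta')
    show "AE p in cyl J. 0 \<le> ?h p"
      using Hpos by (intro AE_I2) (auto intro: less_imp_le)
    show "AE p in cyl J. 0 \<le> ?\<gamma> p \<and> ?\<gamma> p < 1"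
      using \<Gamma>b by (intro AE_I2) auto
    show "Linf J ?\<gamma>"
      unfolding Linf_def
    proof
      have "esssup (cyl J) (\<lambda>p. ennreal \<bar>?\<gamma> p\<bar>) \<le> ennreal 1"
        using \<gamma>m \<Gamma>b by (intro esssup_I AE_I2 ennreal_leI) (auto intro: less_imp_le)
      then show "esssup (cyl J) (\<lambda>p. ennreal \<bar>?\<gamma> p\<bar>) < \<infinity>"
        using ennreal_one_less_top le_less_trans by fastforce
    qed (fact \<gamma>m)
    show "\<exists>sx h4x h3x gx.
        weak_dx J (\<lambda>p. \<sigma> (?\<gamma> p)) sx \<and>
        (G \<noteq> 0 \<longrightarrow> weak_dx J (\<lambda>p. ?h p ^ 4) h4x \<and> weak_dx J (\<lambda>p. ?h p ^ 3) h3x) \<and>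
        (D \<noteq> 0 \<longrightarrow> weak_dx J ?\<gamma> gx) \<and>
        (\<forall>\<phi>. test_function (J \<times> UNIV) \<phi> \<longrightarrow>
           has_bochner_integral (cyl J)
             (\<lambda>p. ?h p * dt \<phi> p + (?h p)\<^sup>2 / 2 * sx p * dx \<phi> p - G / 12 * h4x p * dx \<phi> p) 0 \<and>
           has_bochner_integral (cyl J)
             (\<lambda>p. ?\<gamma> p * dt \<phi> p + ?h p * ?\<gamma> p * sx p * dx \<phi> p - D * gx p * dx \<phi> p
                - G / 6 * ?\<gamma> p * h3x p * dx \<phi> p) 0)"
    proof (intro exI conjI impI allI)
      show "weak_dx J (\<lambda>p. \<sigma> (?\<gamma> p)) (\<lambda>(t, x). s (x - t))"
        using weak_dx_travelling[OF \<sigma>] by (simp add: case_prod_beta')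
      show "weak_dx J (\<lambda>p. ?h p ^ 4) (\<lambda>(t, x). real 4 * H (x - t) ^ (4 - 1) * H' (x - t))"
        "weak_dx J (\<lambda>p. ?h p ^ 3) (\<lambda>(t, x). real 3 * H (x - t) ^ (3 - 1) * H' (x - t))" if "G \<noteq> 0"
        using weak_dx_travelling[OF pow[OF that, of 4]] weak_dx_travelling[OF pow[OF that, of 3]]
        by (simp_all add: case_prod_beta')
      show "weak_dx J ?\<gamma> (\<lambda>(t, x). \<Gamma>' (x - t))" if "D \<noteq> 0"
        using weak_dx_travelling[OF \<Gamma>\<Gamma>[OF that]] .
      fix \<phi> :: "real \<times> real \<Rightarrow> real" assume \<phi>: "test_function (J \<times> UNIV) \<phi>"
      \<comment> \<open>The exponents 4 and 3 from differentiating the powers turn the coefficients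
        \<open>G / 12\<close> and \<open>G / 6\<close> of the weak form into \<open>G / 3\<close>
        and \<open>G / 2\<close> of the flux identities. The constants of integration are
        \<open>h\<close> and 0.\<close>
      let ?C1 = "\<lambda>\<xi>. (H \<xi>)\<^sup>2 / 2 * s \<xi> - G / 12 * (real 4 * H \<xi> ^ (4 - 1) * H' \<xi>)"
      let ?C2 = "\<lambda>\<xi>. H \<xi> * \<Gamma> \<xi> * s \<xi> - D * \<Gamma>' \<xi> - G / 6 * \<Gamma> \<xi> * (real 3 * H \<xi> ^ (3 - 1) * H' \<xi>)"
      have "?C1 \<xi> = H \<xi> - h" "?C2 \<xi> = \<Gamma> \<xi> - 0" for \<xi>
        using flux1[of \<xi>] flux2[of \<xi>] by (simp_all add: algebra_simps)
      from travelling_integral_identity[OF \<phi> J(1) H Hbd this(1)]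
        travelling_integral_identity[OF \<phi> J(1) \<Gamma>m \<Gamma>bd this(2)]
      show "has_bochner_integral (cyl J)
          (\<lambda>p. ?h p * dt \<phi> p + (?h p)\<^sup>2 / 2 * (\<lambda>(t, x). s (x - t)) p * dx \<phi> p
            - G / 12 * (\<lambda>(t, x). real 4 * H (x - t) ^ (4 - 1) * H' (x - t)) p * dx \<phi> p) 0"
        "has_bochner_integral (cyl J)
          (\<lambda>p. ?\<gamma> p * dt \<phi> p + ?h p * ?\<gamma> p * (\<lambda>(t, x). s (x - t)) p * dx \<phi> p
            - D * (\<lambda>(t, x). \<Gamma>' (x - t)) p * dx \<phi> p
            - G / 6 * ?\<gamma> p * (\<lambda>(t, x). real 3 * H (x - t) ^ (3 - 1) * H' (x - t)) p * dx \<phi> p) 0"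
        by (simp_all add: case_prod_beta' algebra_simps)
    qed
  qed
  moreover have "is_interval {0::real<..}"
    by (auto simp: is_interval_1)
  moreover have "\<not> bounded {0::real<..}"
  proof
    assume "bounded {0::real<..}"
    then obtain b :: real where "\<forall>x\<in>{0<..}. \<bar>x\<bar> \<le> b" by (auto simp: bounded_iff)
    moreover have "\<bar>b\<bar> + 1 \<in> {0<..}" by (simp add: add_nonneg_pos)
    ultimately have "\<bar>\<bar>b\<bar> + 1\<bar> \<le> b" by blast
    then show False by linarith
  qed
  ultimately show ?thesis
    unfolding weak_solution_def by auto
qed

section \<open>Inverse functions and exponential averages\<close>

lemma continuous_surj_of_unbounded:
  fixes P :: "real \<Rightarrow> real"
  assumes "connected S" "continuous_on S P" "\<And>y. \<exists>z\<in>S. y \<le> P z" "\<And>y. \<exists>z\<in>S. P z \<le> y"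
  shows "P ` S = UNIV"
proof -
  have "connected (P ` S)" using assms connected_continuous_image by blast
  then have "y \<in> P ` S" for y
    using assms(3)[of y] assms(4)[of y] unfolding connected_iff_interval by blast
  then show ?thesis by auto
qed

text \<open>Separation of variables: if \<open>P\<close> is a primitive of \<open>p\<close> that
  maps \<open>S\<close> onto the line, its inverse solves the autonomous equation with right-hand
  side \<open>1 / p\<close>, for all times. The strict sign of \<open>p\<close> gives injectivity
  and the inverse function rule.\<close>

lemma decreasing_inverse:
  fixes P p :: "real \<Rightarrow> real"
  assumes S: "open S" "is_interval S" and onto: "P ` S = UNIV"
    and P: "\<And>z. z \<in> S \<Longrightarrow> (P has_real_derivative p z) (at z)" and p: "\<And>z. z \<in> S \<Longrightarrow> p z < 0"
  obtains Q where "\<And>\<xi>. Q \<xi> \<in> S" "\<And>\<xi>. P (Q \<xi>) = \<xi>" "\<And>z. z \<in> S \<Longrightarrow> Q (P z) = z"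
    "\<And>\<xi>. (Q has_real_derivative 1 / p (Q \<xi>)) (at \<xi>)" "antimono Q"
proof -
  have dec: "P y < P x" if "x \<in> S" "y \<in> S" "x < y" for x y
  proof (rule DERIV_neg_imp_decreasing[OF that(3)])
    fix z assume "x \<le> z" "z \<le> y"
    then have "z \<in> S" using S(2) that unfolding is_interval_1 by blast
    then show "\<exists>d. (P has_real_derivative d) (at z) \<and> d < 0" using P p by blast
  qed
  have inj: "inj_on P S"
    by (rule linorder_inj_onI) (use dec in force)+
  define Q where "Q = inv_into S P"
  have Q: "Q \<xi> \<in> S" "P (Q \<xi>) = \<xi>" for \<xi>
    using onto by (simp_all add: Q_def inv_into_into f_inv_into_f)
  have QP: "Q (P z) = z" if "z \<in> S" for z
    using inj that by (simp add: Q_def)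
  have "isCont Q \<xi>" for \<xi>
  proof -
    obtain e where e: "0 < e" "cball (Q \<xi>) e \<subseteq> S"
      using S(1) Q(1)[of \<xi>] open_contains_cball by blast
    have "isCont Q (P (Q \<xi>))"
    proof (rule isCont_inverse_function2[where f=P and x="Q \<xi>" and a="Q \<xi> - e" and b="Q \<xi> + e"])
      show "Q \<xi> - e < Q \<xi>" "Q \<xi> < Q \<xi> + e" using e by auto
      fix z assume "Q \<xi> - e \<le> z" "z \<le> Q \<xi> + e"
      then have "z \<in> S" using e(2) by (auto simp: cball_eq_atLeastAtMost)
      then show "Q (P z) = z" "isCont P z" using QP P DERIV_isCont by blast+
    qed
    then show ?thesis by (simp add: Q)
  qed
  then have "(Q has_real_derivative inverse (p (Q \<xi>))) (at \<xi>)" for \<xi>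
    using P[OF Q(1)] p[OF Q(1), of \<xi>] Q(2)
    by (intro DERIV_inverse_function[where f=P and a="\<xi> - 1" and b="\<xi> + 1"]) auto
  moreover have "antimono Q"
  proof (rule antimonoI)
    show "Q y \<le> Q x" if "x \<le> y" for x y
      using dec[OF Q(1) Q(1), of x y] that by (cases "Q x < Q y") (simp_all add: Q not_less)
  qed
  ultimately show thesis
    using that[of Q] Q QP by (simp add: inverse_eq_divide)
qed

text \<open>\<open>Q\<close> takes every value \<open>z\<close> between \<open>a\<close> and
  \<open>b\<close> at the point \<open>P z\<close> and is monotone, so it stays below
  \<open>z\<close> from there on. No continuity is involved, which suits fronts obtained by
  choice.\<close>

lemma antimono_tendsto_at_top:
  fixes Q :: "real \<Rightarrow> real"
  assumes "antimono Q" "\<And>\<xi>. a < Q \<xi>" "a < b" "\<And>z. a < z \<Longrightarrow> z < b \<Longrightarrow> Q (P z) = z"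
  shows "(Q \<longlongrightarrow> a) at_top"
proof (rule order_tendstoI)
  show "\<forall>\<^sub>F x in at_top. y < Q x" if "y < a" for y
    using assms(2) that by (intro always_eventually) (meson order.strict_trans)
  fix y assume "a < y"
  then obtain z where z: "a < z" "z < y" "z < b" using assms(3) dense[of a "min y b"] by auto
  show "\<forall>\<^sub>F x in at_top. Q x < y"
    using eventually_ge_at_top[of "P z"]
  proof eventually_elim
    case (elim x)
    then show ?case using antimonoD[OF assms(1) elim] assms(4)[of z] z by linarith
  qed
qed

lemma antimono_tendsto_at_bot:
  fixes Q :: "real \<Rightarrow> real"
  assumes "antimono Q" "\<And>\<xi>. Q \<xi> < b" "a < b" "\<And>z. a < z \<Longrightarrow> z < b \<Longrightarrow> Q (P z) = z"
  shows "(Q \<longlongrightarrow> b) at_bot"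
proof (rule order_tendstoI)
  show "\<forall>\<^sub>F x in at_bot. Q x < y" if "b < y" for y
    using assms(2) that by (intro always_eventually) (meson order.strict_trans)
  fix y assume "y < b"
  then obtain z where z: "y < z" "z < b" "a < z" using assms(3) dense[of "max y a" b] by auto
  show "\<forall>\<^sub>F x in at_bot. y < Q x"
    using eventually_le_at_bot[of "P z"]
  proof eventually_elim
    case (elim x)
    then show ?case using antimonoD[OF assms(1) elim] assms(4)[of z] z by linarith
  qed
qed

text \<open>With \<open>x = exp s\<close> this is the integral of
  \<open>exp (s - \<tau>) * u s\<close> over all \<open>s\<close> up to \<tau>, an average over the
  past with total weight 1. The substitution replaces the half line by a compact interval.\<close>

definition exp_average :: "(real \<Rightarrow> real) \<Rightarrow> real \<Rightarrow> real" where
  "exp_average u \<tau> = exp (- \<tau>) * integral {0..exp \<tau>} (\<lambda>x. u (ln x))"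

lemma integrable_ln:
  fixes u :: "real \<Rightarrow> real"
  assumes "continuous_on UNIV u" "bounded (range u)"
  shows "(\<lambda>x. u (ln x)) integrable_on {a..b}"
proof -
  have [measurable]: "u \<in> borel_measurable borel" using assms(1) by (rule borel_measurable_continuous_onI)
  obtain B where "\<forall>x. \<bar>u x\<bar> \<le> B" using assms(2) by (auto simp: bounded_iff)
  then have "set_integrable lborel {a..b} (\<lambda>x. u (ln x))"
    unfolding set_integrable_def
    by (intro integrableI_bounded_set_indicator[where B=B]) (auto intro!: AE_I2 simp: emeasure_lborel_Icc_eq)
  then show ?thesis by (rule set_borel_integral_eq_integral)
qed

lemma integral_ln_has_derivative:
  fixes u :: "real \<Rightarrow> real"
  assumes "continuous_on UNIV u" "bounded (range u)" "0 < y"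
  shows "((\<lambda>y. integral {0..y} (\<lambda>x. u (ln x))) has_real_derivative u (ln y)) (at y)"
proof -
  \<comment> \<open>The right end \<open>y + 1\<close> puts \<open>y\<close> in the interior, so the
    one-sided statement becomes a two-sided derivative.\<close>
  have "continuous (at y within {0..y+1}) (\<lambda>x. u (ln x))"
  proof -
    have "isCont u (ln y)" using assms(1) continuous_on_eq_continuous_at by blast
    with isCont_ln[of y] assms(3) have "isCont (\<lambda>x. u (ln x)) y"
      by (intro isCont_o2[of y ln u]) auto
    then show ?thesis using continuous_at_imp_continuous_at_within by blast
  qed
  then have "((\<lambda>y. integral {0..y} (\<lambda>x. u (ln x))) has_vector_derivative u (ln y)) (at y within {0..y+1})"
    using integral_has_vector_derivative_continuous_at[OF integrable_ln[OF assms(1,2)], of y 0 "y+1" "{}"] assms(3)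
    by auto
  moreover have "at y within {0..y+1} = at y"
    using assms(3) by (intro at_within_interior) auto
  ultimately show ?thesis by (simp add: has_real_derivative_iff_has_vector_derivative)
qed

lemma exp_average_has_derivative:
  assumes "continuous_on UNIV u" "bounded (range u)"
  shows "(exp_average u has_real_derivative u \<tau> - exp_average u \<tau>) (at \<tau>)"
proof -
  have "((\<lambda>\<tau>. integral {0..exp \<tau>} (\<lambda>x. u (ln x))) has_real_derivative u (ln (exp \<tau>)) * exp \<tau>) (at \<tau>)"
    by (rule DERIV_chain2[OF integral_ln_has_derivative[OF assms exp_gt_zero] DERIV_exp])
  then have "((\<lambda>\<tau>. exp (- \<tau>) * integral {0..exp \<tau>} (\<lambda>x. u (ln x))) has_real_derivative
     (- exp (- \<tau>)) * integral {0..exp \<tau>} (\<lambda>x. u (ln x)) + (u \<tau> * exp \<tau>) * exp (- \<tau>)) (at \<tau>)"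
    by (intro DERIV_mult) (auto intro!: derivative_eq_intros)
  then show ?thesis
    unfolding exp_average_def by (simp add: exp_minus field_simps)
qed

lemma exp_average_mono:
  assumes "continuous_on UNIV u" "bounded (range u)" "continuous_on UNIV v" "bounded (range v)"
    "\<And>x. u x \<le> v x"
  shows "exp_average u \<tau> \<le> exp_average v \<tau>"
  unfolding exp_average_def
  using assms by (intro mult_left_mono integral_le integrable_ln) auto

lemma exp_average_const: "exp_average (\<lambda>_. c) \<tau> = c"
  by (simp add: exp_average_def exp_minus)

lemma exp_average_add_const:
  assumes "continuous_on UNIV u" "bounded (range u)"
  shows "exp_average (\<lambda>x. u x + c) \<tau> = exp_average u \<tau> + c"
proof -
  have "integral {0..exp \<tau>} (\<lambda>x. u (ln x) + c) = integral {0..exp \<tau>} (\<lambda>x. u (ln x)) + c * exp \<tau>"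
    using integrable_ln[OF assms] by (subst integral_add) auto
  then show ?thesis by (simp add: exp_average_def exp_minus field_simps)
qed

lemma exp_average_bounds:
  assumes "continuous_on UNIV u" "\<And>x. a \<le> u x \<and> u x \<le> b"
  shows "a \<le> exp_average u \<tau> \<and> exp_average u \<tau> \<le> b"
proof -
  have "bounded (range u)"
    using assms(2) by (intro boundedI[where B="max \<bar>a\<bar> \<bar>b\<bar>"]) (smt (verit) imageE real_norm_def)
  then show ?thesis
    using exp_average_mono[OF continuous_on_const _ assms(1), of a \<tau>]
      exp_average_mono[OF assms(1) _ continuous_on_const, of b \<tau>] assms(2)
    by (auto simp: exp_average_const)
qed

text \<open>The average is \<open>A y / y\<close> at \<open>y = exp \<tau>\<close>, and
  \<open>A\<close> has derivative \<open>u (ln y)\<close>. Thus l'Hopital's rule transfers the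
  limits of \<open>u\<close>, with \<open>y\<close> tending to 0 in the past and to infinity in the
  future.\<close>

lemma exp_average_tendsto:
  assumes u: "continuous_on UNIV u" "bounded (range u)"
  shows "(u \<longlongrightarrow> l) at_bot \<Longrightarrow> (exp_average u \<longlongrightarrow> l) at_bot"
    "(u \<longlongrightarrow> l) at_top \<Longrightarrow> (exp_average u \<longlongrightarrow> l) at_top"
proof -
  define A where "A y = integral {0..y} (\<lambda>x. u (ln x))" for y
  have dA: "(A has_real_derivative u (ln y)) (at y)" if "0 < y" for y
    using integral_ln_has_derivative[OF u that] unfolding A_def .
  have exp0: "filterlim (exp :: real \<Rightarrow> real) (at_right 0) at_bot"
    by (simp add: filterlim_at exp_at_bot)
  show "(exp_average u \<longlongrightarrow> l) at_bot" if "(u \<longlongrightarrow> l) at_bot"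
  proof -
    have A0: "(A \<longlongrightarrow> 0) (at_right 0)"
    proof -
      have "continuous_on {0..1} A"
        unfolding A_def using integrable_ln[OF u] by (rule indefinite_integral_continuous_1)
      then have "(A \<longlongrightarrow> A 0) (at 0 within {0..1})"
        by (simp add: continuous_on_def)
      then show ?thesis
        by (simp add: at_within_Icc_at_right A_def)
    qed
    have "((\<lambda>y. A y / y) \<longlongrightarrow> l) (at_right 0)"
    proof (rule lhopital_right)
      have "\<forall>\<^sub>F y in at_right 0. (0::real) < y" by (rule eventually_at_right_less)
      then show "\<forall>\<^sub>F y in at_right 0. y \<noteq> (0::real)" "\<forall>\<^sub>F y in at_right 0. (A has_real_derivative u (ln y)) (at y)"
        by (auto elim!: eventually_mono intro!: dA)
      show "((\<lambda>y. u (ln y) / 1) \<longlongrightarrow> l) (at_right 0)"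
        using filterlim_compose[OF that ln_at_0] by simp
    qed (use A0 in auto)
    from filterlim_compose[OF this exp0]
    show ?thesis
      by (simp add: exp_average_def[abs_def] A_def exp_minus divide_inverse mult.commute)
  qed
  show "(exp_average u \<longlongrightarrow> l) at_top" if "(u \<longlongrightarrow> l) at_top"
  proof -
    \<comment> \<open>The end \<open>y = \<infinity>\<close> is moved to \<open>z = 1 / y\<close>
      near 0, where the form of l'Hopital's rule with only the denominator tending to infinity
      applies. \<open>A\<close> need not have a limit.\<close>
    have "((\<lambda>z. A (1 / z) / (1 / z)) \<longlongrightarrow> l) (at_right 0)"
    proof (rule lhopital_right_0_at_top)
      have pos: "\<forall>\<^sub>F z in at_right 0. (0::real) < z" by (rule eventually_at_right_less)
      show "LIM z at_right 0. 1 / z :> (at_top :: real filter)"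
        using filterlim_inverse_at_top_right by (simp add: inverse_eq_divide)
      show "\<forall>\<^sub>F z in at_right 0. ((\<lambda>z. A (1 / z)) has_real_derivative u (ln (1 / z)) * (- (1 / z\<^sup>2))) (at z)"
        using pos
      proof eventually_elim
        case (elim z)
        have "((\<lambda>z. 1 / z) has_real_derivative - (1 / z\<^sup>2)) (at z)"
          using elim by (auto intro!: derivative_eq_intros simp: power2_eq_square)
        then show ?case using elim by (intro DERIV_chain2[OF dA]) auto
      qed
      show "\<forall>\<^sub>F z in at_right 0. ((\<lambda>z. 1 / z) has_real_derivative - (1 / z\<^sup>2)) (at z)"
        using pos by eventually_elim (auto intro!: derivative_eq_intros simp: power2_eq_square)
      show "\<forall>\<^sub>F z in at_right 0. - (1 / z\<^sup>2) \<noteq> (0::real)"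
        using pos by eventually_elim auto
      have "((\<lambda>z. u (ln (1 / z))) \<longlongrightarrow> l) (at_right 0)"
        using filterlim_compose[OF that filterlim_compose[OF ln_at_top filterlim_inverse_at_top_right]]
        by (simp add: inverse_eq_divide)
      then show "((\<lambda>z. u (ln (1 / z)) * (- (1 / z\<^sup>2)) / - (1 / z\<^sup>2)) \<longlongrightarrow> l) (at_right 0)"
        by (rule Lim_transform_eventually) (use pos in \<open>eventually_elim, auto\<close>)
    qed
    from filterlim_compose[OF this filterlim_compose[OF exp0 filterlim_uminus_at_bot_at_top]]
    show ?thesis
      by (simp add: exp_average_def[abs_def] A_def exp_minus divide_inverse mult.commute)
  qed
qed

section \<open>Heteroclinic solutions\<close>

text \<open>The fixed points of \<open>u \<mapsto> exp_average f(\<cdot>, u)\<close> are the bounded solutions of \<open>u' = f(\<cdot>, u) - u\<close> on the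
  whole line; the boundary conditions at \<open>\<plusminus>\<infinity>\<close> define a closed invariant set.\<close>

lemma heteroclinic_exists:
  fixes p r w :: "real \<Rightarrow> real"
  assumes AB: "A \<le> B" and q: "0 \<le> q" "q < 1"
    and p: "\<And>y. y \<in> {A..B} \<Longrightarrow> p y \<in> {A..B}" "\<And>y z. y \<in> {A..B} \<Longrightarrow> z \<in> {A..B} \<Longrightarrow> \<bar>p y - p z\<bar> \<le> q * \<bar>y - z\<bar>" "p A = A"
    and r: "\<And>y. y \<in> {A..B} \<Longrightarrow> r y \<in> {A..B}" "\<And>y z. y \<in> {A..B} \<Longrightarrow> z \<in> {A..B} \<Longrightarrow> \<bar>r y - r z\<bar> \<le> q * \<bar>y - z\<bar>" "r B = B"
    and w: "continuous_on UNIV w" "\<And>\<tau>. 0 \<le> w \<tau> \<and> w \<tau> \<le> 1" "(w \<longlongrightarrow> 0) at_bot" "(w \<longlongrightarrow> 1) at_top"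
  obtains u where "\<And>\<tau>. u \<tau> \<in> {A..B}"
    "\<And>\<tau>. (u has_real_derivative w \<tau> * p (u \<tau>) + (1 - w \<tau>) * r (u \<tau>) - u \<tau>) (at \<tau>)"
    "(u \<longlongrightarrow> B) at_bot" "(u \<longlongrightarrow> A) at_top"
proof -
  \<comment> \<open>The weight shifts from \<open>r\<close>, which fixes \<open>B\<close>, in the
    past to \<open>p\<close>, which fixes \<open>A\<close>, in the future.\<close>
  define f where "f u \<tau> = w \<tau> * p (u \<tau>) + (1 - w \<tau>) * r (u \<tau>)" for u \<tau>
  define S :: "(real \<Rightarrow>\<^sub>C real) set" where "S = {u. (\<forall>\<tau>. apply_bcontfun u \<tau> \<in> {A..B}) \<and>
    (apply_bcontfun u \<longlongrightarrow> B) at_bot \<and> (apply_bcontfun u \<longlongrightarrow> A) at_top}"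
  have convex: "A \<le> a * x + (1 - a) * y \<and> a * x + (1 - a) * y \<le> B"
    if "0 \<le> a \<and> a \<le> 1" "x \<in> {A..B}" "y \<in> {A..B}" for a x y :: real
    using convexD[OF convex_real_interval(5), of x A B y a "1 - a"] that by auto
  have fAB: "A \<le> f u \<tau> \<and> f u \<tau> \<le> B" if "\<And>\<tau>. u \<tau> \<in> {A..B}" for u \<tau>
    unfolding f_def by (intro convex w p r that)
  have lipc: "continuous_on {A..B} p" "continuous_on {A..B} r"
    using p(2) r(2) q by (auto intro!: lipschitz_on_continuous_on[where L=q] lipschitz_onI simp: dist_real_def)
  have fc: "continuous_on UNIV (f u)" if "continuous_on UNIV u" "\<And>\<tau>. u \<tau> \<in> {A..B}" for u
  proof -
    have "continuous_on UNIV (\<lambda>\<tau>. p (u \<tau>))" "continuous_on UNIV (\<lambda>\<tau>. r (u \<tau>))"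
      using lipc that by (auto intro: continuous_on_compose2)
    then show ?thesis
      unfolding f_def[abs_def] using w(1) by (intro continuous_intros)
  qed
  have fb: "bounded (range (f u))" if "\<And>\<tau>. u \<tau> \<in> {A..B}" for u
    using fAB[of u] that by (intro boundedI[where B="max \<bar>A\<bar> \<bar>B\<bar>"]) (smt (verit) imageE real_norm_def)
  have S: "continuous_on UNIV (apply_bcontfun u)" "apply_bcontfun u \<tau> \<in> {A..B}" if "u \<in> S" for u \<tau>
    using that by (auto simp: S_def)
  define T where "T u = Bcontfun (exp_average (f (apply_bcontfun u)))" for u :: "real \<Rightarrow>\<^sub>C real"
  have Tb: "A \<le> exp_average (f (apply_bcontfun u)) \<tau> \<and> exp_average (f (apply_bcontfun u)) \<tau> \<le> B" if "u \<in> S" for u \<tau>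
    using exp_average_bounds fc fAB S[OF that] by metis
  have Td: "(exp_average (f (apply_bcontfun u)) has_real_derivative f (apply_bcontfun u) \<tau> - exp_average (f (apply_bcontfun u)) \<tau>) (at \<tau>)" if "u \<in> S" for u \<tau>
    by (intro exp_average_has_derivative fc fb S[OF that])
  have T: "apply_bcontfun (T u) = exp_average (f (apply_bcontfun u))" if "u \<in> S" for u
  proof -
    have "exp_average (f (apply_bcontfun u)) \<in> bcontfun"
      unfolding bcontfun_def
    proof (intro CollectI conjI)
      show "continuous_on UNIV (exp_average (f (apply_bcontfun u)))"
        using Td[OF that] by (meson DERIV_isCont continuous_at_imp_continuous_on)
      show "bounded (range (exp_average (f (apply_bcontfun u))))"
        using Tb[OF that] by (intro boundedI[where B="max \<bar>A\<bar> \<bar>B\<bar>"]) (smt (verit) imageE real_norm_def)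
    qed
    then show ?thesis by (simp add: T_def Bcontfun_inverse)
  qed
  \<comment> \<open>Where \<open>w\<close> is small, \<open>f u\<close> differs from
    \<open>r (u \<tau>)\<close> by at most \<open>w\<close> times the length of the interval, and
    \<open>r\<close> contracts towards its fixed point \<open>B\<close>; symmetrically for
    \<open>p\<close> and \<open>A\<close>. This preserves the limits.\<close>
  have near: "\<bar>f u \<tau> - B\<bar> \<le> \<bar>w \<tau>\<bar> * (B - A) + q * \<bar>u \<tau> - B\<bar>" "\<bar>f u \<tau> - A\<bar> \<le> \<bar>1 - w \<tau>\<bar> * (B - A) + q * \<bar>u \<tau> - A\<bar>"
    if u: "\<And>\<tau>. u \<tau> \<in> {A..B}" for u \<tau>
  proof -
    have 1: "r (u \<tau>) \<in> {A..B}" "p (u \<tau>) \<in> {A..B}" "\<bar>r (u \<tau>) - B\<bar> \<le> q * \<bar>u \<tau> - B\<bar>" "\<bar>p (u \<tau>) - A\<bar> \<le> q * \<bar>u \<tau> - A\<bar>"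
      using r(1,3) p(1,3) r(2)[of "u \<tau>" B] p(2)[of "u \<tau>" A] u[of \<tau>] AB by auto
    have e: "f u \<tau> - B = w \<tau> * (p (u \<tau>) - r (u \<tau>)) + (r (u \<tau>) - B)"
      "f u \<tau> - A = (1 - w \<tau>) * (r (u \<tau>) - p (u \<tau>)) + (p (u \<tau>) - A)"
      unfolding f_def by algebra+
    have m: "\<bar>w \<tau> * (p (u \<tau>) - r (u \<tau>))\<bar> \<le> \<bar>w \<tau>\<bar> * (B - A)" "\<bar>(1 - w \<tau>) * (r (u \<tau>) - p (u \<tau>))\<bar> \<le> \<bar>1 - w \<tau>\<bar> * (B - A)"
      unfolding abs_mult using 1 by (intro mult_left_mono; auto)+
    show "\<bar>f u \<tau> - B\<bar> \<le> \<bar>w \<tau>\<bar> * (B - A) + q * \<bar>u \<tau> - B\<bar>"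
      unfolding e by (rule order_trans[OF abs_triangle_ineq add_mono[OF m(1) 1(3)]])
    show "\<bar>f u \<tau> - A\<bar> \<le> \<bar>1 - w \<tau>\<bar> * (B - A) + q * \<bar>u \<tau> - A\<bar>"
      unfolding e by (rule order_trans[OF abs_triangle_ineq add_mono[OF m(2) 1(4)]])
  qed
  have "\<exists>!u\<in>S. T u = u"
  proof (rule Banach_fix[OF _ _ q])
    show "complete S"
    proof -
      \<comment> \<open>Membership in \<open>S\<close> includes conditions at infinity; they survive
        because convergence of bounded continuous functions is uniform and limits may be
        interchanged.\<close>
      have "closed S"
        unfolding closed_sequential_limits
      proof (intro allI impI, elim conjE)
        fix x :: "nat \<Rightarrow> real \<Rightarrow>\<^sub>C real" and l
        assume x: "\<forall>n. x n \<in> S" and l: "x \<longlonglongrightarrow> l"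
        have ul: "uniform_limit UNIV (\<lambda>n. apply_bcontfun (x n)) l sequentially"
          using l by (rule tendsto_bcontfun_uniform_limit)
        have pt: "(\<lambda>n. x n \<tau>) \<longlonglongrightarrow> l \<tau>" for \<tau>
          using tendsto_uniform_limitI[OF ul] by simp
        have "l \<tau> \<in> {A..B}" for \<tau>
          using x by (intro closed_sequentially[OF closed_atLeastAtMost _ pt]) (auto simp: S_def)
        moreover have "(l \<longlongrightarrow> B) at_bot"
          by (rule swap_uniform_limit'[where f="\<lambda>n. apply_bcontfun (x n)" and S=UNIV and F=sequentially and g="\<lambda>_. B"])
            (use x ul in \<open>auto simp: S_def\<close>)
        moreover have "(l \<longlongrightarrow> A) at_top"
          by (rule swap_uniform_limit'[where f="\<lambda>n. apply_bcontfun (x n)" and S=UNIV and F=sequentially and g="\<lambda>_. A"])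
            (use x ul in \<open>auto simp: S_def\<close>)
        ultimately show "l \<in> S" by (simp add: S_def)
      qed
      then show ?thesis by (simp add: complete_eq_closed)
    qed
    show "S \<noteq> {}"
    proof -
      \<comment> \<open>Interpolating between \<open>B\<close> and \<open>A\<close> with the weight
        itself gives an element with the required limits.\<close>
      define g where "g \<tau> = B + w \<tau> * (A - B)" for \<tau>
      have gAB: "g \<tau> \<in> {A..B}" for \<tau>
        using convex[of "w \<tau>" A B] w(2) AB by (simp add: g_def algebra_simps)
      have "continuous_on UNIV g" unfolding g_def using w(1) by (intro continuous_intros)
      moreover have "bounded (range g)"
        using gAB by (intro bounded_subset[OF bounded_closed_interval[of A B]]) (auto simp: cbox_interval)
      ultimately have "apply_bcontfun (Bcontfun g) = g"
        by (simp add: Bcontfun_inverse bcontfun_def)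
      moreover have "(g \<longlongrightarrow> B + 0 * (A - B)) at_bot" "(g \<longlongrightarrow> B + 1 * (A - B)) at_top"
        unfolding g_def by (rule tendsto_add tendsto_mult tendsto_const w(3,4))+
      ultimately have "Bcontfun g \<in> S" using gAB by (simp add: S_def)
      then show ?thesis by blast
    qed
    show "T ` S \<subseteq> S"
    proof safe
      fix u assume u: "u \<in> S"
      note uAB = S(2)[OF u]
      have lim: "(u \<longlongrightarrow> B) at_bot" "(u \<longlongrightarrow> A) at_top" using u unfolding S_def by blast+
      have "((\<lambda>\<tau>. \<bar>w \<tau>\<bar> * (B - A) + q * \<bar>u \<tau> - B\<bar>) \<longlongrightarrow> \<bar>0\<bar> * (B - A) + q * \<bar>B - B\<bar>) at_bot"
        by (rule tendsto_add tendsto_mult tendsto_diff tendsto_rabs tendsto_const w(3) lim)+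
      then have "((\<lambda>\<tau>. \<bar>w \<tau>\<bar> * (B - A) + q * \<bar>u \<tau> - B\<bar>) \<longlongrightarrow> 0) at_bot" by simp
      then have "((\<lambda>\<tau>. f u \<tau> - B) \<longlongrightarrow> 0) at_bot"
        by (rule Lim_null_comparison[rotated]) (use near(1)[of u, OF uAB] in simp)
      then have 1: "(f u \<longlongrightarrow> B) at_bot" by (simp add: LIM_zero_iff)
      have "((\<lambda>\<tau>. \<bar>1 - w \<tau>\<bar> * (B - A) + q * \<bar>u \<tau> - A\<bar>) \<longlongrightarrow> \<bar>1 - 1\<bar> * (B - A) + q * \<bar>A - A\<bar>) at_top"
        by (rule tendsto_add tendsto_mult tendsto_diff tendsto_rabs tendsto_const w(4) lim)+
      then have "((\<lambda>\<tau>. \<bar>1 - w \<tau>\<bar> * (B - A) + q * \<bar>u \<tau> - A\<bar>) \<longlongrightarrow> 0) at_top" by simp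
      then have "((\<lambda>\<tau>. f u \<tau> - A) \<longlongrightarrow> 0) at_top"
        by (rule Lim_null_comparison[rotated]) (use near(2)[of u, OF uAB] in simp)
      then have 2: "(f u \<longlongrightarrow> A) at_top" by (simp add: LIM_zero_iff)
      have "(exp_average (f u) \<longlongrightarrow> B) at_bot" "(exp_average (f u) \<longlongrightarrow> A) at_top"
        using exp_average_tendsto[OF fc fb] 1 2 S[OF u] by blast+
      then show "T u \<in> S" using Tb[OF u] by (simp add: S_def T[OF u])
    qed
    show "dist (T u) (T v) \<le> q * dist u v" if "u \<in> S" "v \<in> S" for u v
    proof (rule dist_bound)
      fix \<tau>
      \<comment> \<open>A one-sided comparison with an added constant passes through the average by
        monotonicity; exchanging \<open>a\<close> and \<open>b\<close> then gives the contraction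
        estimate.\<close>
      have le: "f a \<tau> \<le> f b \<tau> + q * dist a b" if "a \<in> S" "b \<in> S" for a b :: "real \<Rightarrow>\<^sub>C real" and \<tau>
      proof -
        have d: "q * \<bar>a \<tau> - b \<tau>\<bar> \<le> q * dist a b"
          using dist_bounded[of a \<tau> b] q by (intro mult_left_mono) (auto simp: dist_real_def)
        have "p (a \<tau>) \<le> p (b \<tau>) + q * dist a b" "r (a \<tau>) \<le> r (b \<tau>) + q * dist a b"
          using p(2)[OF S(2)[OF that(1)] S(2)[OF that(2)], of \<tau> \<tau>] r(2)[OF S(2)[OF that(1)] S(2)[OF that(2)], of \<tau> \<tau>] d by linarith+
        then have "f a \<tau> \<le> w \<tau> * (p (b \<tau>) + q * dist a b) + (1 - w \<tau>) * (r (b \<tau>) + q * dist a b)"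
          unfolding f_def using w(2)[of \<tau>] by (intro add_mono mult_left_mono) auto
        also have "\<dots> = f b \<tau> + q * dist a b" by (simp add: f_def algebra_simps)
        finally show ?thesis .
      qed
      have ave: "exp_average (f a) \<tau> \<le> exp_average (f b) \<tau> + q * dist a b" if "a \<in> S" "b \<in> S" for a b :: "real \<Rightarrow>\<^sub>C real"
      proof -
        have fb': "bounded (range (\<lambda>\<tau>. f b \<tau> + q * dist a b))"
          using bounded_plus_comp[OF fb[of b, OF S(2)[OF that(2)]], of "\<lambda>_. q * dist a b"] by (auto simp: bounded_iff)
        have "exp_average (f a) \<tau> \<le> exp_average (\<lambda>\<tau>. f b \<tau> + q * dist a b) \<tau>"
          using that S fb' by (intro exp_average_mono fc fb continuous_intros le) auto
        also have "\<dots> = exp_average (f b) \<tau> + q * dist a b"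
          using that S by (intro exp_average_add_const fc fb) auto
        finally show ?thesis .
      qed
      show "dist (T u \<tau>) (T v \<tau>) \<le> q * dist u v"
        using ave[OF that] ave[OF that(2,1)] by (simp add: T that dist_real_def dist_commute)
    qed
  qed
  then obtain u where u: "u \<in> S" "T u = u" by blast
  \<comment> \<open>At the fixed point the derivative formula for averages becomes the differential
    equation, so differentiability of \<open>u\<close> comes from the averaging.\<close>
  have Tu: "exp_average (f (apply_bcontfun u)) = apply_bcontfun u" using T[OF u(1)] u(2) by simp
  show thesis
  proof (rule that[of "apply_bcontfun u"])
    show "(apply_bcontfun u has_real_derivative w \<tau> * p (u \<tau>) + (1 - w \<tau>) * r (u \<tau>) - u \<tau>) (at \<tau>)" for \<tau>
      using Td[OF u(1), of \<tau>] unfolding Tu by (simp add: f_def)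
  qed (use u(1) in \<open>auto simp: S_def\<close>)
qed

section \<open>The height equation on the interval from \<open>h\<close> to
  \<open>2 * h\<close>\<close>

lemma increasing_two_sided_Lipschitz:
  fixes \<phi> \<phi>' :: "real \<Rightarrow> real"
  assumes AB: "A \<le> B" and d: "\<And>y. y \<in> {A..B} \<Longrightarrow> (\<phi> has_real_derivative \<phi>' y) (at y)"
    and c: "continuous_on {A..B} \<phi>'" and pos: "\<And>y. y \<in> {A..B} \<Longrightarrow> 0 < \<phi>' y"
  obtains m M where "0 < m" "m \<le> M"
    "\<And>y z. A \<le> z \<Longrightarrow> z \<le> y \<Longrightarrow> y \<le> B \<Longrightarrow> m * (y - z) \<le> \<phi> y - \<phi> z \<and> \<phi> y - \<phi> z \<le> M * (y - z)"
proof -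
  have ne: "{A..B} \<noteq> {}" "compact {A..B}" using AB by auto
  \<comment> \<open>The derivative attains its minimum and maximum on the compact interval; by the
    mean value theorem these bound all difference quotients, and the minimum is positive.\<close>
  obtain a where a: "a \<in> {A..B}" "\<forall>y\<in>{A..B}. \<phi>' a \<le> \<phi>' y"
    using continuous_attains_inf[OF ne(2,1) c] by blast
  obtain b where b: "b \<in> {A..B}" "\<forall>y\<in>{A..B}. \<phi>' y \<le> \<phi>' b"
    using continuous_attains_sup[OF ne(2,1) c] by blast
  show thesis
  proof (rule that[of "\<phi>' a" "\<phi>' b"])
    show "0 < \<phi>' a" "\<phi>' a \<le> \<phi>' b" using a b pos by auto
    fix y z assume yz: "A \<le> z" "z \<le> y" "y \<le> B"
    show "\<phi>' a * (y - z) \<le> \<phi> y - \<phi> z \<and> \<phi> y - \<phi> z \<le> \<phi>' b * (y - z)"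
    proof (cases "z = y")
      case False
      then obtain x where x: "z < x" "x < y" "\<phi> y - \<phi> z = (y - z) * \<phi>' x"
        using MVT2[of z y \<phi> \<phi>'] yz d by auto
      moreover have "\<phi>' a \<le> \<phi>' x" "\<phi>' x \<le> \<phi>' b" using a b x yz by auto
      ultimately show ?thesis using yz by (simp add: mult.commute mult_left_mono)
    qed simp
  qed
qed

text \<open>Moving by a small multiple \<kappa> against an increasing function with positive slope
  is a contraction. The two resulting maps fix \<open>h\<close> and \<open>2 * h\<close>, where the
  two terms of the equation vanish, so the heteroclinic lemma applies.\<close>

lemma height_equation_solvable:
  fixes h :: real
  assumes h: "0 < h"
  obtains \<kappa> where "0 < \<kappa>"
    "\<And>w. continuous_on UNIV w \<Longrightarrow> (\<And>\<tau>. 0 \<le> w \<tau> \<and> w \<tau> \<le> 1) \<Longrightarrow> (w \<longlongrightarrow> 0) at_bot \<Longrightarrow> (w \<longlongrightarrow> 1) at_top \<Longrightarrow>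
      \<exists>u. (\<forall>\<tau>. h \<le> u \<tau> \<and> u \<tau> \<le> 2 * h) \<and> (u \<longlongrightarrow> 2 * h) at_bot \<and> (u \<longlongrightarrow> h) at_top \<and>
        (\<forall>\<tau>. (u has_real_derivative
            - \<kappa> * (w \<tau> * ((u \<tau> - h) / ((u \<tau>)\<^sup>2 * (3 * h - u \<tau>)))
              - (1 - w \<tau>) * ((2 * h - u \<tau>) / (2 * u \<tau> * (3 * h - u \<tau>))))) (at \<tau>))"
proof -
  define a where "a y = (y - h) / (y\<^sup>2 * (3 * h - y))" for y
  \<comment> \<open>The sign is opposite to that in the equation, so that both \<open>a\<close> and
    \<open>b\<close> are increasing; their derivatives follow.\<close>
  define b where "b y = (y - 2 * h) / (2 * y * (3 * h - y))" for y
  define a' where "a' y = (2 * (y\<^sup>2 - 3 * h * y + 3 * h\<^sup>2)) / (y ^ 3 * (3 * h - y)\<^sup>2)" for y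
  define b' where "b' y = (y\<^sup>2 - 4 * h * y + 6 * h\<^sup>2) / (2 * y\<^sup>2 * (3 * h - y)\<^sup>2)" for y
  have nz: "y \<noteq> 0" "3 * h - y \<noteq> 0" if "y \<in> {h..2*h}" for y using that h by auto
  have da: "(a has_real_derivative a' y) (at y)" if "y \<in> {h..2*h}" for y
  proof -
    have "(a has_real_derivative (1 * (y\<^sup>2 * (3 * h - y)) - (y - h) * (2 * y * (3 * h - y) - y\<^sup>2)) / (y\<^sup>2 * (3 * h - y))\<^sup>2) (at y)"
      unfolding a_def[abs_def] using nz[OF that] by (auto intro!: derivative_eq_intros simp: power2_eq_square)
    moreover have "(1 * (y\<^sup>2 * (3 * h - y)) - (y - h) * (2 * y * (3 * h - y) - y\<^sup>2)) / (y\<^sup>2 * (3 * h - y))\<^sup>2 = a' y"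
      unfolding a'_def using nz[OF that] by (simp add: divide_simps) algebra
    ultimately show ?thesis by simp
  qed
  have db: "(b has_real_derivative b' y) (at y)" if "y \<in> {h..2*h}" for y
  proof -
    have "(b has_real_derivative (1 * (2 * y * (3 * h - y)) - (y - 2 * h) * (2 * (3 * h - y) - 2 * y)) / (2 * y * (3 * h - y))\<^sup>2) (at y)"
      unfolding b_def[abs_def] using nz[OF that] by (auto intro!: derivative_eq_intros simp: power2_eq_square)
    moreover have "(1 * (2 * y * (3 * h - y)) - (y - 2 * h) * (2 * (3 * h - y) - 2 * y)) / (2 * y * (3 * h - y))\<^sup>2 = b' y"
      unfolding b'_def using nz[OF that] by (simp add: divide_simps) algebra
    ultimately show ?thesis by simp
  qed
  have a'pos: "0 < a' y" and b'pos: "0 < b' y" if "y \<in> {h..2*h}" for y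
  proof -
    \<comment> \<open>Completing squares shows that the quadratic factors in the numerators of
      \<open>a'\<close> and \<open>b'\<close> are positive.\<close>
    have "0 < (y - 3 / 2 * h)\<^sup>2 + 3 / 4 * h\<^sup>2" "0 < (y - 2 * h)\<^sup>2 + 2 * h\<^sup>2"
      using h by (auto intro!: add_nonneg_pos)
    moreover have "(y - 3 / 2 * h)\<^sup>2 + 3 / 4 * h\<^sup>2 = y\<^sup>2 - 3 * h * y + 3 * h\<^sup>2"
      "(y - 2 * h)\<^sup>2 + 2 * h\<^sup>2 = y\<^sup>2 - 4 * h * y + 6 * h\<^sup>2"
      by (simp_all add: power2_eq_square algebra_simps)
    ultimately have "0 < y\<^sup>2 - 3 * h * y + 3 * h\<^sup>2" "0 < y\<^sup>2 - 4 * h * y + 6 * h\<^sup>2"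
      by (simp_all only:)
    then show "0 < a' y" "0 < b' y"
      unfolding a'_def b'_def using nz[OF that] that h by (auto intro!: divide_pos_pos mult_pos_pos)
  qed
  have ca: "continuous_on {h..2*h} a'" and cb: "continuous_on {h..2*h} b'"
    unfolding a'_def b'_def using nz by (auto intro!: continuous_intros)
  have hh: "h \<le> 2 * h" using h by simp
  obtain ma Ma where ma: "0 < ma" "ma \<le> Ma" "\<And>y z. h \<le> z \<Longrightarrow> z \<le> y \<Longrightarrow> y \<le> 2 * h \<Longrightarrow> ma * (y - z) \<le> a y - a z \<and> a y - a z \<le> Ma * (y - z)"
    using increasing_two_sided_Lipschitz[OF hh da ca a'pos] by blast
  obtain mb Mb where mb: "0 < mb" "mb \<le> Mb" "\<And>y z. h \<le> z \<Longrightarrow> z \<le> y \<Longrightarrow> y \<le> 2 * h \<Longrightarrow> mb * (y - z) \<le> b y - b z \<and> b y - b z \<le> Mb * (y - z)"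
    using increasing_two_sided_Lipschitz[OF hh db cb b'pos] by blast
  \<comment> \<open>Small enough that \<kappa> times either upper slope is at most 1. Both maps stay
    nondecreasing, and the smaller lower slope \<open>mm\<close> determines the contraction factor
    \<open>q\<close>.\<close>
  define \<kappa> where "\<kappa> = 1 / (Ma + Mb)"
  define mm where "mm = min ma mb"
  have mm: "0 < mm" "mm \<le> ma" "mm \<le> mb" using ma mb by (auto simp: mm_def)
  define q where "q = 1 - \<kappa> * mm"
  have \<kappa>: "0 < \<kappa>" "\<kappa> * Ma \<le> 1" "\<kappa> * Mb \<le> 1" using ma mb by (auto simp: \<kappa>_def)
  have q: "0 \<le> q" "q < 1"
  proof -
    have "\<kappa> * mm \<le> \<kappa> * Ma" using \<kappa> ma mm by (intro mult_left_mono) auto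
    then show "0 \<le> q" using \<kappa>(2) unfolding q_def by linarith
    show "q < 1" using \<kappa> mm by (simp add: q_def)
  qed
  have step: "0 \<le> (y - \<kappa> * f y) - (z - \<kappa> * f z) \<and> (y - \<kappa> * f y) - (z - \<kappa> * f z) \<le> q * (y - z)"
    if f: "m * (y - z) \<le> f y - f z \<and> f y - f z \<le> M * (y - z)" and m: "mm \<le> m" "\<kappa> * M \<le> 1" and "z \<le> y" for f m M y z
  proof -
    have "\<kappa> * (f y - f z) \<le> \<kappa> * M * (y - z)"
      using f \<kappa> unfolding mult.assoc by (auto intro!: mult_left_mono)
    also have "\<dots> \<le> 1 * (y - z)"
      using m(2) that(4) by (intro mult_right_mono) auto
    finally have 1: "\<kappa> * (f y - f z) \<le> y - z" by simp
    have "\<kappa> * mm * (y - z) \<le> \<kappa> * m * (y - z)"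
      using m(1) \<kappa> that(4) by (intro mult_right_mono mult_left_mono) auto
    also have "\<dots> \<le> \<kappa> * (f y - f z)"
      using f \<kappa> unfolding mult.assoc by (auto intro!: mult_left_mono)
    finally have 2: "(y - z) - \<kappa> * (f y - f z) \<le> q * (y - z)" by (simp add: q_def left_diff_distrib)
    have "(y - \<kappa> * f y) - (z - \<kappa> * f z) = (y - z) - \<kappa> * (f y - f z)" by (simp add: right_diff_distrib)
    with 1 2 show ?thesis by simp
  qed
  define p where "p y = y - \<kappa> * a y" for y
  define r where "r y = y - \<kappa> * b y" for y
  have pm: "0 \<le> p y - p z \<and> p y - p z \<le> q * (y - z)" and rm: "0 \<le> r y - r z \<and> r y - r z \<le> q * (y - z)"
    if "h \<le> z" "z \<le> y" "y \<le> 2 * h" for y z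
    unfolding p_def r_def by (rule step[OF ma(3)] step[OF mb(3)]; use that \<kappa> mm in auto)+
  have lip: "\<bar>p y - p z\<bar> \<le> q * \<bar>y - z\<bar>" "\<bar>r y - r z\<bar> \<le> q * \<bar>y - z\<bar>" if "y \<in> {h..2*h}" "z \<in> {h..2*h}" for y z
    using pm[of z y] pm[of y z] rm[of z y] rm[of y z] that by (cases "z \<le> y"; simp)+
  have fix': "p h = h" "r (2 * h) = 2 * h" by (simp_all add: p_def r_def a_def b_def)
  have qle: "q * (y - z) \<le> y - z" if "z \<le> y" for y z
    using q that by (simp add: mult_left_le_one_le)
  \<comment> \<open>Monotonicity and the fixed points place \<open>p y\<close> between
    \<open>h\<close> and \<open>y\<close>, and \<open>r y\<close> between \<open>y\<close> and
    \<open>2 * h\<close>.\<close>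
  have pr: "p y \<in> {h..2*h}" "r y \<in> {h..2*h}" if "y \<in> {h..2*h}" for y
    using pm[of h y] rm[of y "2*h"] qle[of h y] qle[of y "2*h"] that by (auto simp: fix')
  show thesis
  proof (rule that[OF \<kappa>(1)])
    fix w :: "real \<Rightarrow> real"
    assume w: "continuous_on UNIV w" "\<And>\<tau>. 0 \<le> w \<tau> \<and> w \<tau> \<le> 1" "(w \<longlongrightarrow> 0) at_bot" "(w \<longlongrightarrow> 1) at_top"
    obtain u where u: "\<And>\<tau>. u \<tau> \<in> {h..2*h}"
      "\<And>\<tau>. (u has_real_derivative w \<tau> * p (u \<tau>) + (1 - w \<tau>) * r (u \<tau>) - u \<tau>) (at \<tau>)"
      "(u \<longlongrightarrow> 2 * h) at_bot" "(u \<longlongrightarrow> h) at_top"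
      using heteroclinic_exists[OF hh q pr(1) lip(1) fix'(1) pr(2) lip(2) fix'(2) w] by blast
    have b: "b y = - ((2 * h - y) / (2 * y * (3 * h - y)))" for y
      unfolding b_def minus_divide_left by simp
    have "w \<tau> * p (u \<tau>) + (1 - w \<tau>) * r (u \<tau>) - u \<tau> = - \<kappa> * (w \<tau> * a (u \<tau>) - (1 - w \<tau>) * - b (u \<tau>))" for \<tau>
      unfolding p_def r_def by algebra
    then have "(u has_real_derivative - \<kappa> * (w \<tau> * a (u \<tau>) - (1 - w \<tau>) * - b (u \<tau>))) (at \<tau>)" for \<tau>
      using u(2)[of \<tau>] by simp
    then show "\<exists>u. (\<forall>\<tau>. h \<le> u \<tau> \<and> u \<tau> \<le> 2 * h) \<and> (u \<longlongrightarrow> 2 * h) at_bot \<and> (u \<longlongrightarrow> h) at_top \<and>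
        (\<forall>\<tau>. (u has_real_derivative
            - \<kappa> * (w \<tau> * ((u \<tau> - h) / ((u \<tau>)\<^sup>2 * (3 * h - u \<tau>)))
              - (1 - w \<tau>) * ((2 * h - u \<tau>) / (2 * u \<tau> * (3 * h - u \<tau>))))) (at \<tau>))"
      using u unfolding a_def b minus_minus by (intro exI[of _ u]) simp
  qed
qed

section \<open>Surface tension and the autonomous profile equation\<close>

locale surface_tension =
  fixes \<sigma> \<sigma>' :: "real \<Rightarrow> real"
  assumes deriv_within: "\<And>z. z \<in> {0..<1} \<Longrightarrow> (\<sigma> has_real_derivative \<sigma>' z) (at z within {0..<1})"
    and cont': "continuous_on {0..<1} \<sigma>'"
    and neg: "\<And>z. z \<in> {0..<1} \<Longrightarrow> \<sigma>' z < 0"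
    and not_integrable: "\<not> set_integrable lebesgue {0<..<1} \<sigma>'"
begin

lemma deriv: "(\<sigma> has_real_derivative \<sigma>' z) (at z)" if "z \<in> {0<..<1}"
proof -
  have "at z within {0..<1} = at z" using that by (intro at_within_interior) auto
  then show ?thesis using deriv_within[of z] that by auto
qed

lemma continuous: "continuous_on {0..<1} \<sigma>"
  using deriv_within by (meson DERIV_continuous_on)

lemma decreasing:
  assumes "0 \<le> x" "x < y" "y < 1"
  shows "\<sigma> y < \<sigma> x"
proof -
  show ?thesis
  proof (rule DERIV_neg_imp_decreasing_open[OF assms(2)])
    show "continuous_on {x..y} \<sigma>" using continuous assms by (auto intro: continuous_on_subset)
    show "\<exists>d. (\<sigma> has_real_derivative d) (at z) \<and> d < 0" if "x < z" "z < y" for z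
      using deriv[of z] neg[of z] that assms by auto
  qed
qed

text \<open>Otherwise the decreasing function \<sigma> would have a finite limit at 1, and the
  fundamental theorem would make its derivative integrable on the unit interval.\<close>

lemma unbounded_below: "\<exists>z\<in>{0<..<1}. \<sigma> z < c"
proof (rule ccontr)
  assume "\<not> ?thesis"
  then have c: "c \<le> \<sigma> z" if "z \<in> {0<..<1}" for z using that by force
  define L where "L = Inf (\<sigma> ` {0<..<1})"
  have bdd: "bdd_below (\<sigma> ` {0<..<1})" using c by (intro bdd_belowI[where m=c]) auto
  have Lle: "L \<le> \<sigma> z" if "z \<in> {0<..<1}" for z
    unfolding L_def using bdd that by (auto intro: cInf_lower)
  have ne: "\<sigma> ` {0<..<1} \<noteq> {}" by simp
  have ev: "\<forall>\<^sub>F z in at_left 1. z \<in> {a<..<1}" if "a < 1" for a :: real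
    using eventually_at_left_real[OF that] .
  have left: "(\<sigma> \<longlongrightarrow> L) (at_left 1)"
  proof (rule order_tendstoI)
    show "\<forall>\<^sub>F z in at_left 1. y < \<sigma> z" if "y < L" for y
      using ev[OF zero_less_one]
    proof eventually_elim
      case (elim z)
      then show ?case using Lle[OF elim] that by linarith
    qed
    fix y assume "L < y"
    then obtain x where x: "x \<in> {0<..<1}" "\<sigma> x < y"
      using cInf_lessD[OF ne, of y] by (auto simp: L_def)
    from x(1) have x1: "x < 1" by simp
    show "\<forall>\<^sub>F z in at_left 1. \<sigma> z < y"
      using ev[OF x1]
    proof eventually_elim
      case (elim z)
      then show ?case using decreasing[of x z] x by auto
    qed
  qed
  have right: "(\<sigma> \<longlongrightarrow> \<sigma> 0) (at_right 0)"
  proof -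
    have "continuous_on {0..1/2} \<sigma>" using continuous by (rule continuous_on_subset) auto
    then have "(\<sigma> \<longlongrightarrow> \<sigma> 0) (at 0 within {0..1/2})" by (simp add: continuous_on_def)
    then show ?thesis by (simp add: at_within_Icc_at_right)
  qed
  \<comment> \<open>The sign is changed because the improper fundamental theorem that yields
    integrability is stated for nonnegative integrands.\<close>
  have "set_integrable lborel (einterval 0 1) (\<lambda>z. - \<sigma>' z)"
  proof (rule interval_integral_FTC_nonneg(1)[where F="\<lambda>z. - \<sigma> z" and A="- \<sigma> 0" and B="- L"])
    show "((\<lambda>z. - \<sigma> z) has_real_derivative - \<sigma>' z) (at z)" if "0 < ereal z" "ereal z < 1" for z
      using that by (intro DERIV_minus deriv) auto
    show "isCont (\<lambda>z. - \<sigma>' z) z" if "0 < ereal z" "ereal z < 1" for z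
    proof -
      have "continuous_on {0<..<1} \<sigma>'" using cont' by (rule continuous_on_subset) auto
      then show ?thesis using that by (auto intro!: continuous_minus simp: continuous_on_eq_continuous_at)
    qed
    show "AE z in lborel. 0 < ereal z \<longrightarrow> ereal z < 1 \<longrightarrow> 0 \<le> - \<sigma>' z"
      using neg by (intro AE_I2) (auto intro: less_imp_le)
    show "(((\<lambda>z. - \<sigma> z) \<circ> real_of_ereal) \<longlongrightarrow> - \<sigma> 0) (at_right 0)"
      unfolding zero_ereal_def ereal_tendsto_simps using right by (rule tendsto_minus)
    show "(((\<lambda>z. - \<sigma> z) \<circ> real_of_ereal) \<longlongrightarrow> - L) (at_left 1)"
      unfolding one_ereal_def ereal_tendsto_simps using left by (rule tendsto_minus)
  qed simp
  then have "integrable lborel (\<lambda>z. - (indicator {0<..<1} z *\<^sub>R - \<sigma>' z))"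
    unfolding set_integrable_def by (intro integrable_minus) (simp add: zero_ereal_def one_ereal_def)
  then have "set_integrable lborel {0<..<1} \<sigma>'"
    by (simp add: set_integrable_def)
  then have "set_integrable lebesgue {0<..<1} \<sigma>'"
    unfolding set_integrable_def by (simp add: integrable_completion borel_measurable_integrable)
  then show False using not_integrable by blast
qed

text \<open>Separation of variables for \<open>Q' = - v Q\<close>. The bound by \<open>c / z\<close>
  makes the travel time \<open>P\<close> diverge logarithmically at 0, and the bound by
  \<open>- \<sigma>'\<close> makes it diverge at 1 because \<sigma> is unbounded below. Hence the
  profile exists on the whole line and connects 1 to 0.\<close>

lemma decreasing_profile:
  fixes v :: "real \<Rightarrow> real"
  assumes v: "continuous_on {0<..<1} v" "\<And>z. z \<in> {0<..<1} \<Longrightarrow> 0 < v z"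
    and c: "0 < c" "\<And>z. z \<in> {0<..<1} \<Longrightarrow> c * (- \<sigma>' z) \<le> 1 / v z" "\<And>z. z \<in> {0<..<1} \<Longrightarrow> c / z \<le> 1 / v z"
  obtains P Q where
    "\<And>z. z \<in> {0<..<1} \<Longrightarrow> (P has_real_derivative - (1 / v z)) (at z)"
    "\<And>\<xi>. Q \<xi> \<in> {0<..<1}" "\<And>z. z \<in> {0<..<1} \<Longrightarrow> Q (P z) = z" "\<And>\<xi>. (Q has_real_derivative - v (Q \<xi>)) (at \<xi>)" "antimono Q"
    "(Q \<longlongrightarrow> 1) at_bot" "(Q \<longlongrightarrow> 0) at_top" "filterlim P at_top (at_right 0)" "filterlim P at_bot (at_left 1)"
proof -
  have "\<exists>F. \<forall>z. 0 < ereal z \<longrightarrow> ereal z < 1 \<longrightarrow> (F has_vector_derivative 1 / v z) (at z)"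
  proof (rule einterval_antiderivative)
    show "isCont (\<lambda>z. 1 / v z) z" if "0 < ereal z" "ereal z < 1" for z
      using v that by (auto intro!: continuous_intros simp: continuous_on_eq_continuous_at less_imp_neq[symmetric])
  qed simp
  then obtain F where F: "\<And>z. z \<in> {0<..<1} \<Longrightarrow> (F has_real_derivative 1 / v z) (at z)"
    by (auto simp: has_real_derivative_iff_has_vector_derivative)
  define P where "P z = - F z" for z
  have P: "(P has_real_derivative - (1 / v z)) (at z)" if "z \<in> {0<..<1}" for z
    unfolding P_def[abs_def] by (intro DERIV_minus F that)
  have onto: "P ` {0<..<1} = UNIV"
  proof (rule continuous_surj_of_unbounded)
    show "continuous_on {0<..<1} P"
      using P by (meson DERIV_isCont continuous_at_imp_continuous_on)
    fix y
    show "\<exists>z\<in>{0<..<1}. y \<le> P z"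
    proof -
      \<comment> \<open>Chosen by solving for \<open>z\<close> the inequality that results from
        comparing \<open>F\<close> with \<open>c * ln\<close> between \<open>z\<close> and
        \<open>1/2\<close>.\<close>
      define z where "z = min (1/2) (exp ((- y - F (1/2) + c * ln (1/2)) / c))"
      have z: "0 < z" "z \<le> 1/2" by (auto simp: z_def)
      have "(F z - c * ln z) \<le> (F (1/2) - c * ln (1/2))"
      proof (rule DERIV_nonneg_imp_nondecreasing[OF z(2)])
        fix x assume x: "z \<le> x" "x \<le> 1/2"
        then have "((\<lambda>x. F x - c * ln x) has_real_derivative 1 / v x - c / x) (at x)"
          using z by (auto intro!: derivative_eq_intros F)
        then show "\<exists>d. ((\<lambda>x. F x - c * ln x) has_real_derivative d) (at x) \<and> 0 \<le> d"
          using c(3)[of x] x z by (intro exI[of _ "1 / v x - c / x"]) auto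
      qed
      moreover have "ln z \<le> (- y - F (1/2) + c * ln (1/2)) / c"
        using ln_mono[of z "exp ((- y - F (1/2) + c * ln (1/2)) / c)"] z(1) by (simp add: z_def)
      then have "c * ln z \<le> - y - F (1/2) + c * ln (1/2)" using c(1) by (simp add: field_simps)
      ultimately have "y \<le> P z" by (simp add: P_def)
      then show ?thesis using z by auto
    qed
    show "\<exists>z\<in>{0<..<1}. P z \<le> y"
    proof -
      \<comment> \<open>The first entry of the minimum forces \<open>z\<close> beyond
        \<open>1/2\<close>, where the comparison of \<open>F\<close> with
        \<open>- c * \<sigma>\<close> starts; the second makes \<open>P z\<close> at most
        \<open>y\<close>.\<close>
      obtain z where z: "z \<in> {0<..<1}" "\<sigma> z < min (\<sigma> (1/2)) ((y + F (1/2) + c * \<sigma> (1/2)) / c)"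
        using unbounded_below by blast
      have half: "1/2 \<le> z" using decreasing[of z "1/2"] z by force
      have "(F (1/2) + c * \<sigma> (1/2)) \<le> (F z + c * \<sigma> z)"
      proof (rule DERIV_nonneg_imp_nondecreasing[OF half])
        fix x assume x: "1/2 \<le> x" "x \<le> z"
        then have "((\<lambda>x. F x + c * \<sigma> x) has_real_derivative 1 / v x + c * \<sigma>' x) (at x)"
          using z by (auto intro!: derivative_eq_intros F deriv)
        then show "\<exists>d. ((\<lambda>x. F x + c * \<sigma> x) has_real_derivative d) (at x) \<and> 0 \<le> d"
          using c(2)[of x] x z by (intro exI[of _ "1 / v x + c * \<sigma>' x"]) auto
      qed
      moreover have "c * \<sigma> z \<le> y + F (1/2) + c * \<sigma> (1/2)" using z(2) c(1) by (simp add: field_simps)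
      ultimately have "P z \<le> y" by (simp add: P_def)
      then show ?thesis using z by blast
    qed
  qed auto
  have "is_interval {0<..<1::real}" by (simp add: is_interval_1)
  from decreasing_inverse[OF open_greaterThanLessThan this onto P]
  obtain Q where Q: "\<And>\<xi>. Q \<xi> \<in> {0<..<1}" "\<And>\<xi>. P (Q \<xi>) = \<xi>" "\<And>z. z \<in> {0<..<1} \<Longrightarrow> Q (P z) = z"
    "\<And>\<xi>. (Q has_real_derivative 1 / - (1 / v (Q \<xi>))) (at \<xi>)" "antimono Q"
    using v(2) by (auto simp: less_imp_neq[symmetric])
  have less: "P z < K" if "z \<in> {0<..<1}" "Q K < z" for z K
    using antimonoD[OF Q(5), of K "P z"] Q(3)[OF that(1)] that(2) by force
  have greater: "K < P z" if "z \<in> {0<..<1}" "z < Q K" for z K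
    using antimonoD[OF Q(5), of "P z" K] Q(3)[OF that(1)] that(2) by force
  show thesis
  proof (rule that[OF P Q(1,3) _ Q(5)])
    show "(Q has_real_derivative - v (Q \<xi>)) (at \<xi>)" for \<xi> using Q(4)[of \<xi>] by simp
    show "(Q \<longlongrightarrow> 1) at_bot" "(Q \<longlongrightarrow> 0) at_top"
      using antimono_tendsto_at_top[of Q 0 1 P] antimono_tendsto_at_bot[of Q 1 0 P] Q by auto
    show "filterlim P at_top (at_right 0)"
      unfolding filterlim_at_top_dense
    proof
      fix K
      have "\<forall>\<^sub>F z in at_right 0. z \<in> {0<..<Q K}" using Q(1)[of K] by (intro eventually_at_right_real) auto
      then show "\<forall>\<^sub>F z in at_right 0. K < P z"
        by eventually_elim (use greater[of _ K] Q(1)[of K] in auto)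
    qed
    show "filterlim P at_bot (at_left 1)"
      unfolding filterlim_at_bot_dense
    proof
      fix K
      have "\<forall>\<^sub>F z in at_left 1. z \<in> {Q K<..<1}" using Q(1)[of K] by (intro eventually_at_left_real) auto
      then show "\<forall>\<^sub>F z in at_left 1. P z < K"
        by eventually_elim (use less[of _ K] Q(1)[of K] in auto)
    qed
  qed
qed

end

section \<open>Travelling waves\<close>

lemma smooth_off_0_C1:
  assumes "\<And>x. (f has_real_derivative f' x) (at x)" "continuous_on UNIV f'"
  shows "smooth_off_0 f f'"
  unfolding smooth_off_0_def
proof (intro conjI allI impI assms(1))
  show "continuous_on UNIV f" using assms(1) by (meson DERIV_isCont continuous_at_imp_continuous_on)
  show "f' \<in> borel_measurable borel" using assms(2) by (rule borel_measurable_continuous_onI)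
  show "bounded (f' ` {-r..r})" for r
    using assms(2) by (intro compact_imp_bounded compact_continuous_image) (auto intro: continuous_on_subset)
qed

text \<open>Behind the front the film has constant height \<open>2 * h\<close>; ahead of it the
  equation \<open>G * H ^ 3 * H' = - 3 * (H - h)\<close> is separable. Its solution approaches
  \<open>h\<close> without reaching it because the travel time diverges logarithmically at
  \<open>h\<close>.\<close>

lemma draining_profile:
  fixes h G :: real
  assumes h: "0 < h" and G: "0 < G"
  obtains H where "smooth_off_0 H (\<lambda>\<xi>. if \<xi> < 0 then 0 else - 3 * (H \<xi> - h) / (G * H \<xi> ^ 3))"
    "\<And>\<xi>. h \<le> H \<xi> \<and> H \<xi> \<le> 2 * h" "\<And>\<xi>. \<xi> < 0 \<Longrightarrow> H \<xi> = 2 * h" "(H \<longlongrightarrow> 2 * h) at_bot" "(H \<longlongrightarrow> h) at_top"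
proof -
  \<comment> \<open>Primitive of \<open>p\<close>, obtained from the division
    \<open>y ^ 3 / (y - h) = y ^ 2 + h * y + h ^ 2 + h ^ 3 / (y - h)\<close>.\<close>
  define P where "P y = - (G / 3) * (y ^ 3 / 3 + h * y\<^sup>2 / 2 + h\<^sup>2 * y + h ^ 3 * ln (y - h))" for y
  define p where "p y = - (G / 3) * (y ^ 3 / (y - h))" for y
  have P: "(P has_real_derivative p y) (at y)" if "y \<in> {h<..}" for y
  proof -
    have d1: "((\<lambda>y. y ^ 3 / 3 + h * y\<^sup>2 / 2 + h\<^sup>2 * y) has_real_derivative y\<^sup>2 + h * y + h\<^sup>2) (at y)"
      by (auto intro!: derivative_eq_intros)
    have d2: "((\<lambda>y. h ^ 3 * ln (y - h)) has_real_derivative h ^ 3 * (1 / (y - h))) (at y)"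
      using that by (auto intro!: derivative_eq_intros)
    from DERIV_cmult[OF DERIV_add[OF d1 d2], of "- (G / 3)"]
    have "(P has_real_derivative - (G / 3) * (y\<^sup>2 + h * y + h\<^sup>2 + h ^ 3 * (1 / (y - h)))) (at y)"
      unfolding P_def[abs_def] .
    moreover have "y\<^sup>2 + h * y + h\<^sup>2 + h ^ 3 * (1 / (y - h)) = y ^ 3 / (y - h)"
      using that by (simp add: field_simps power2_eq_square power3_eq_cube)
    ultimately show ?thesis unfolding p_def by (simp only:)
  qed
  have p: "p y < 0" if "y \<in> {h<..}" for y
    using that h G by (simp add: p_def)
  have onto: "P ` {h<..} = UNIV"
  proof (rule continuous_surj_of_unbounded)
    show "continuous_on {h<..} P"
      using P by (meson DERIV_isCont continuous_at_imp_continuous_on)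
    fix K
    show "\<exists>z\<in>{h<..}. K \<le> P z"
    proof -
      \<comment> \<open>Bounds the polynomial part of \<open>P\<close> at
        \<open>h + exp (- t)\<close>, since \<open>exp (- t) \<le> 1\<close>; the logarithm there
        equals \<open>- t\<close>.\<close>
      define c where "c = (h + 1) ^ 3 / 3 + h * (h + 1)\<^sup>2 / 2 + h\<^sup>2 * (h + 1)"
      define t where "t = max 0 ((K * 3 / G + c) / h ^ 3)"
      have t: "0 \<le> t" "K * 3 / G + c \<le> h ^ 3 * t"
        using h by (auto simp: t_def max_def field_simps)
      have "(h + exp (- t)) ^ 3 / 3 + h * (h + exp (- t))\<^sup>2 / 2 + h\<^sup>2 * (h + exp (- t)) \<le> c"
        unfolding c_def using h t(1) by (intro add_mono divide_right_mono mult_left_mono power_mono) auto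
      with t(2) have "K * 3 / G \<le> - ((h + exp (- t)) ^ 3 / 3 + h * (h + exp (- t))\<^sup>2 / 2 + h\<^sup>2 * (h + exp (- t)) - h ^ 3 * t)"
        by linarith
      from mult_left_mono[OF this, of "G / 3"] have "K \<le> P (h + exp (- t))"
        using G by (simp add: P_def algebra_simps)
      then show ?thesis by (intro bexI[of _ "h + exp (- t)"]) auto
    qed
    show "\<exists>z\<in>{h<..}. P z \<le> K"
    proof -
      \<comment> \<open>With \<open>1 \<le> t\<close> the logarithm is nonnegative, so the term
        \<open>h ^ 2 * t\<close> alone pushes \<open>P (h + t)\<close> below
        \<open>K\<close>.\<close>
      define t where "t = max 1 (- K * 3 / (G * h\<^sup>2))"
      have t: "1 \<le> t" "- K * 3 / G \<le> h\<^sup>2 * t"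
        using h G by (auto simp: t_def max_def field_simps)
      have "0 \<le> (h + t) ^ 3 / 3 + h * (h + t)\<^sup>2 / 2 + h\<^sup>2 * h + h ^ 3 * ln t"
        using h t(1) by (intro add_nonneg_nonneg mult_nonneg_nonneg) auto
      then have "h\<^sup>2 * t \<le> (h + t) ^ 3 / 3 + h * (h + t)\<^sup>2 / 2 + h\<^sup>2 * (h + t) + h ^ 3 * ln t"
        unfolding distrib_left[of "h\<^sup>2"] by linarith
      also have "\<dots> = - (3 / G * P (h + t))" using G by (simp add: P_def)
      finally have "- K * 3 / G \<le> - (3 / G * P (h + t))" using t(2) by linarith
      then have "P (h + t) \<le> K" using G by (simp add: field_simps)
      then show ?thesis using t by (intro bexI[of _ "h + t"]) auto
    qed
  qed auto
  have "is_interval {h<..}" by (simp add: is_interval_1)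
  from decreasing_inverse[OF open_greaterThan this onto P p]
  obtain Q where Q: "\<And>\<xi>. Q \<xi> \<in> {h<..}" "\<And>\<xi>. P (Q \<xi>) = \<xi>" "\<And>z. z \<in> {h<..} \<Longrightarrow> Q (P z) = z"
    "\<And>\<xi>. (Q has_real_derivative 1 / p (Q \<xi>)) (at \<xi>)" "antimono Q"
    by blast
  \<comment> \<open>The shift by \<open>P (2 * h)\<close> starts the solution at height
    \<open>2 * h\<close>, and the maximum freezes it there behind the front.\<close>
  define H where "H \<xi> = Q (max \<xi> 0 + P (2 * h))" for \<xi>
  have Q0: "Q (P (2 * h)) = 2 * h" using Q(3) h by simp
  have H: "h < H \<xi>" "H \<xi> \<le> 2 * h" for \<xi>
    using Q(1) antimonoD[OF Q(5), of "P (2 * h)" "max \<xi> 0 + P (2 * h)"] Q0 by (auto simp: H_def)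
  have Hneg: "H \<xi> = 2 * h" if "\<xi> \<le> 0" for \<xi> using that Q0 by (simp add: H_def max_def)
  have cQ: "continuous_on UNIV Q" using Q(4) by (meson DERIV_isCont continuous_at_imp_continuous_on)
  \<comment> \<open>At the kink \<open>\<xi> = 0\<close> the value from ahead of the front is taken,
    so that the flux identity holds there as well.\<close>
  let ?H' = "\<lambda>\<xi>. if \<xi> < 0 then 0 else - 3 * (H \<xi> - h) / (G * H \<xi> ^ 3)"
  have cH: "continuous_on UNIV H"
    unfolding H_def by (intro continuous_on_compose2[OF cQ] continuous_intros) auto
  then have [measurable]: "H \<in> borel_measurable borel" by (rule borel_measurable_continuous_onI)
  have "smooth_off_0 H ?H'"
    unfolding smooth_off_0_def
  proof (intro conjI allI impI cH)
    show "?H' \<in> borel_measurable borel" by measurable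
    have "\<bar>?H' \<xi>\<bar> \<le> 3 * h / (G * h ^ 3)" for \<xi>
    proof -
      define T where "T = 3 * (H \<xi> - h) / (G * H \<xi> ^ 3)"
      have "T \<le> 3 * h / (G * h ^ 3)"
        unfolding T_def using H[of \<xi>] h G by (intro frac_le mult_left_mono power_mono mult_pos_pos) auto
      moreover have "0 \<le> T"
        unfolding T_def using H[of \<xi>] h G by (intro divide_nonneg_nonneg mult_nonneg_nonneg) auto
      moreover have "?H' \<xi> = (if \<xi> < 0 then 0 else - T)"
        unfolding T_def minus_divide_left by simp
      ultimately show ?thesis by simp
    qed
    then show "bounded (?H' ` {-r..r})" for r unfolding bounded_iff real_norm_def by blast
    fix \<xi> :: real assume "\<xi> \<noteq> 0"
    then consider "\<xi> < 0" | "0 < \<xi>" by linarith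
    then show "(H has_real_derivative ?H' \<xi>) (at \<xi>)"
    proof cases
      case 1
      have "((\<lambda>_. 2 * h) has_real_derivative 0) (at \<xi>)" by simp
      then have "(H has_real_derivative 0) (at \<xi>)"
        by (rule has_field_derivative_transform_within_open[where S="{..<0::real}"]) (use 1 Hneg in auto)
      then show ?thesis using 1 by simp
    next
      case 2
      have "1 / p (H \<xi>) = - 3 * (H \<xi> - h) / (G * H \<xi> ^ 3)"
        using H(1)[of \<xi>] h G by (simp add: p_def divide_simps)
      then have "(Q has_real_derivative ?H' \<xi>) (at (\<xi> + P (2 * h)))"
        using Q(4)[of "\<xi> + P (2 * h)"] 2 by (simp add: H_def)
      then have "((\<lambda>\<xi>. Q (\<xi> + P (2 * h))) has_real_derivative ?H' \<xi>) (at \<xi>)"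
        by (simp only: DERIV_shift)
      then show ?thesis
        by (rule has_field_derivative_transform_within_open[where S="{0<..}"]) (use 2 in \<open>auto simp: H_def\<close>)
    qed
  qed
  moreover have "(H \<longlongrightarrow> 2 * h) at_bot"
    by (rule tendsto_eventually, rule eventually_mono[OF eventually_le_at_bot[of 0]]) (rule Hneg)
  moreover have "(H \<longlongrightarrow> h) at_top"
  proof -
    have "(Q \<longlongrightarrow> h) at_top"
      using antimono_tendsto_at_top[of Q h "h + 1" P] Q by auto
    moreover have "filterlim (\<lambda>\<xi>::real. max \<xi> 0 + P (2 * h)) at_top at_top"
      unfolding filterlim_at_top
    proof
      fix Z
      show "\<forall>\<^sub>F \<xi> in at_top. Z \<le> max \<xi> 0 + P (2 * h)"
        using eventually_ge_at_top[of "Z - P (2 * h)"] by eventually_elim (simp add: max_def; linarith)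
    qed
    ultimately show ?thesis unfolding H_def[abs_def] by (rule filterlim_compose)
  qed
  ultimately show thesis using that[of H] H Hneg by (auto intro: less_imp_le)
qed

section \<open>The surfactant front and the reduction to scalar profiles\<close>

context surface_tension begin

text \<open>Only \<sigma> composed with \<Gamma> is constructed to be piecewise affine, and \<Gamma>
  is recovered because \<sigma> decreases from \<open>\<sigma> 0\<close> to minus infinity. For
  \<open>H = 2 * h\<close> both fluxes, with \<open>D = 0\<close> and \<open>H' = 0\<close>, force
  the slope \<open>1 / (2 * h)\<close>.\<close>

lemma surfactant_front:
  assumes h: "0 < h"
  obtains \<Gamma> where "antimono \<Gamma>" "\<And>\<xi>. 0 \<le> \<Gamma> \<xi> \<and> \<Gamma> \<xi> < 1" "\<And>\<xi>. 0 \<le> \<xi> \<Longrightarrow> \<Gamma> \<xi> = 0"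
    "smooth_off_0 (\<lambda>\<xi>. \<sigma> (\<Gamma> \<xi>)) (\<lambda>\<xi>. if \<xi> < 0 then 1 / (2 * h) else 0)"
    "(\<Gamma> \<longlongrightarrow> 1) at_bot" "(\<Gamma> \<longlongrightarrow> 0) at_top"
proof -
  have "\<exists>z. z \<in> {0..<1} \<and> \<sigma> z = \<sigma> 0 + min \<xi> 0 / (2 * h)" for \<xi>
  proof -
    have le: "\<sigma> 0 + min \<xi> 0 / (2 * h) \<le> \<sigma> 0" using h by (simp add: divide_nonpos_pos)
    obtain z where z: "z \<in> {0<..<1}" "\<sigma> z < \<sigma> 0 + min \<xi> 0 / (2 * h)" using unbounded_below by blast
    have "continuous_on {0..z} \<sigma>" using continuous by (rule continuous_on_subset) (use z in auto)
    then obtain x where "0 \<le> x" "x \<le> z" "\<sigma> x = \<sigma> 0 + min \<xi> 0 / (2 * h)"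
      using IVT2'[of \<sigma> z "\<sigma> 0 + min \<xi> 0 / (2 * h)" 0] z le by auto
    then show ?thesis using z by (intro exI[of _ x]) auto
  qed
  then obtain \<Gamma> where \<Gamma>: "\<And>\<xi>. \<Gamma> \<xi> \<in> {0..<1}" "\<And>\<xi>. \<sigma> (\<Gamma> \<xi>) = \<sigma> 0 + min \<xi> 0 / (2 * h)" by metis
  have mono: "x \<le> y" if "\<sigma> y \<le> \<sigma> x" "x \<in> {0..<1}" "y \<in> {0..<1}" for x y
    using decreasing[of y x] that by force
  have anti: "antimono \<Gamma>"
  proof (rule antimonoI)
    fix x y :: real assume "x \<le> y"
    then have "\<sigma> (\<Gamma> x) \<le> \<sigma> (\<Gamma> y)" unfolding \<Gamma>(2) using h by (auto intro!: divide_right_mono)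
    then show "\<Gamma> y \<le> \<Gamma> x" using mono \<Gamma>(1) by blast
  qed
  have pos: "\<Gamma> \<xi> = 0" if "0 \<le> \<xi>" for \<xi>
  proof (rule antisym)
    have "\<sigma> 0 \<le> \<sigma> (\<Gamma> \<xi>)" using \<Gamma>(2)[of \<xi>] that by simp
    then show "\<Gamma> \<xi> \<le> 0" by (rule mono) (use \<Gamma>(1) in auto)
  qed (use \<Gamma>(1)[of \<xi>] in auto)
  have "smooth_off_0 (\<lambda>\<xi>. \<sigma> (\<Gamma> \<xi>)) (\<lambda>\<xi>. if \<xi> < 0 then 1 / (2 * h) else 0)"
    unfolding \<Gamma>(2) smooth_off_0_def
  proof (intro conjI allI impI)
    show "continuous_on UNIV (\<lambda>\<xi>. \<sigma> 0 + min \<xi> 0 / (2 * h))" using h by (intro continuous_intros) auto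
    show "(\<lambda>\<xi>::real. if \<xi> < 0 then 1 / (2 * h) else 0) \<in> borel_measurable borel" by measurable
    show "bounded ((\<lambda>\<xi>::real. if \<xi> < 0 then 1 / (2 * h) else 0) ` {-r..r})" for r
      unfolding bounded_iff using h by (intro exI[of _ "1 / (2 * h)"]) auto
    fix \<xi> :: real assume "\<xi> \<noteq> 0"
    then consider "\<xi> < 0" | "0 < \<xi>" by linarith
    then show "((\<lambda>\<xi>. \<sigma> 0 + min \<xi> 0 / (2 * h)) has_real_derivative (if \<xi> < 0 then 1 / (2 * h) else 0)) (at \<xi>)"
    proof cases
      case 1
      have "((\<lambda>\<xi>. \<sigma> 0 + \<xi> / (2 * h)) has_real_derivative 1 / (2 * h)) (at \<xi>)"
        using h by (auto intro!: derivative_eq_intros)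
      then have "((\<lambda>\<xi>. \<sigma> 0 + min \<xi> 0 / (2 * h)) has_real_derivative 1 / (2 * h)) (at \<xi>)"
        by (rule has_field_derivative_transform_within_open[where S="{..<0::real}"]) (use 1 in auto)
      then show ?thesis using 1 by simp
    next
      case 2
      have "((\<lambda>\<xi>. \<sigma> 0) has_real_derivative 0) (at \<xi>)" by simp
      then have "((\<lambda>\<xi>. \<sigma> 0 + min \<xi> 0 / (2 * h)) has_real_derivative 0) (at \<xi>)"
        by (rule has_field_derivative_transform_within_open[where S="{0<..}"]) (use 2 in auto)
      then show ?thesis using 2 by simp
    qed
  qed
  moreover have "(\<Gamma> \<longlongrightarrow> 0) at_top"
    by (rule tendsto_eventually, rule eventually_mono[OF eventually_ge_at_top[of 0]]) (rule pos)
  moreover have "(\<Gamma> \<longlongrightarrow> 1) at_bot"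
  proof (rule antimono_tendsto_at_bot[OF anti])
    fix z :: real assume z: "0 < z" "z < 1"
    \<comment> \<open>The point where the affine function takes the value \<open>\<sigma> z\<close>;
      it lies behind the front since \<sigma> decreases.\<close>
    let ?\<xi> = "2 * h * (\<sigma> z - \<sigma> 0)"
    have "?\<xi> \<le> 0" using decreasing[of 0 z] z h by (simp add: mult_le_0_iff)
    then have "\<sigma> (\<Gamma> ?\<xi>) = \<sigma> z" using \<Gamma>(2)[of ?\<xi>] h by (simp add: min_def)
    then show "\<Gamma> ?\<xi> = z" using mono[of z "\<Gamma> ?\<xi>"] mono[of "\<Gamma> ?\<xi>" z] \<Gamma>(1)[of ?\<xi>] z by auto
  qed (use \<Gamma>(1) in auto)
  ultimately show thesis using that[of \<Gamma>] anti pos \<Gamma>(1) by auto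
qed

text \<open>With \<open>H = \<eta> (\<Gamma> \<xi>)\<close> and
  \<open>\<Gamma>' = - v \<Gamma>\<close> the chain rule turns both flux identities into pointwise
  identities in \<open>z = \<Gamma> \<xi>\<close>. What remains in each case with diffusion is to
  find \<eta> and \<open>v\<close>; the constant \<open>c\<close> guarantees that \<Gamma> exists on
  the whole line.\<close>

lemma advected_wave:
  fixes D G h :: real and \<eta> \<eta>' v :: "real \<Rightarrow> real"
  assumes h: "0 < h"
    and \<eta>: "continuous_on {0<..<1} \<eta>" "\<And>z. z \<in> {0<..<1} \<Longrightarrow> h \<le> \<eta> z \<and> \<eta> z \<le> 2 * h"
      "(\<eta> \<longlongrightarrow> 2 * h) (at_left 1)" "(\<eta> \<longlongrightarrow> h) (at_right 0)"
    and \<eta>': "\<And>z. G \<noteq> 0 \<Longrightarrow> z \<in> {0<..<1} \<Longrightarrow> (\<eta> has_real_derivative \<eta>' z) (at z)"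
      "G \<noteq> 0 \<Longrightarrow> continuous_on {0<..<1} \<eta>'"
    and v: "continuous_on {0<..<1} v" "\<And>z. z \<in> {0<..<1} \<Longrightarrow> 0 < v z"
    and c: "0 < c" "\<And>z. z \<in> {0<..<1} \<Longrightarrow> c * (- \<sigma>' z) \<le> 1 / v z" "\<And>z. z \<in> {0<..<1} \<Longrightarrow> c / z \<le> 1 / v z"
    and flux1: "\<And>z. z \<in> {0<..<1} \<Longrightarrow> (\<eta> z)\<^sup>2 / 2 * (\<sigma>' z * - v z) - G / 3 * \<eta> z ^ 3 * (\<eta>' z * - v z) = \<eta> z - h"
    and flux2: "\<And>z. z \<in> {0<..<1} \<Longrightarrow>
      \<eta> z * z * (\<sigma>' z * - v z) - D * - v z - G / 2 * z * (\<eta> z)\<^sup>2 * (\<eta>' z * - v z) = z"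
  shows "\<exists>H \<Gamma>. weak_solution D G \<sigma> {0<..} (\<lambda>(t, x). H (x - t)) (\<lambda>(t, x). \<Gamma> (x - t)) \<and>
      (H \<longlongrightarrow> 2 * h) at_bot \<and> (H \<longlongrightarrow> h) at_top \<and> (\<Gamma> \<longlongrightarrow> 1) at_bot \<and> (\<Gamma> \<longlongrightarrow> 0) at_top \<and> antimono \<Gamma>"
proof -
  obtain P \<Gamma> where \<Gamma>: "\<And>\<xi>. \<Gamma> \<xi> \<in> {0<..<1}" "\<And>\<xi>. (\<Gamma> has_real_derivative - v (\<Gamma> \<xi>)) (at \<xi>)" "antimono \<Gamma>"
    "(\<Gamma> \<longlongrightarrow> 1) at_bot" "(\<Gamma> \<longlongrightarrow> 0) at_top"
    by (rule decreasing_profile[OF v c]) blast+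
  have c\<Gamma>: "continuous_on UNIV \<Gamma>"
    using \<Gamma>(2) by (meson DERIV_isCont continuous_at_imp_continuous_on)
  have comp: "continuous_on UNIV (\<lambda>\<xi>. f (\<Gamma> \<xi>))" if "continuous_on {0<..<1} f" for f :: "real \<Rightarrow> real"
    by (rule continuous_on_compose2[OF that c\<Gamma>]) (use \<Gamma>(1) in auto)
  have c\<sigma>': "continuous_on {0<..<1} \<sigma>'" using cont' by (rule continuous_on_subset) auto
  define H where "H \<xi> = \<eta> (\<Gamma> \<xi>)" for \<xi>
  have "weak_solution D G \<sigma> {0<..} (\<lambda>(t, x). H (x - t)) (\<lambda>(t, x). \<Gamma> (x - t))"
  proof (rule weak_solution_travelling[OF h _ _ \<Gamma>(3)])
    show "H \<in> borel_measurable borel"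
      unfolding H_def by (rule borel_measurable_continuous_onI) (rule comp[OF \<eta>(1)])
    show "h \<le> H \<xi> \<and> H \<xi> \<le> 2 * h" "0 \<le> \<Gamma> \<xi> \<and> \<Gamma> \<xi> < 1" for \<xi>
      using \<eta>(2)[OF \<Gamma>(1)] \<Gamma>(1)[of \<xi>] by (auto simp: H_def)
    show "smooth_off_0 (\<lambda>\<xi>. \<sigma> (\<Gamma> \<xi>)) (\<lambda>\<xi>. \<sigma>' (\<Gamma> \<xi>) * - v (\<Gamma> \<xi>))"
      by (intro smooth_off_0_C1 DERIV_chain2[OF deriv[OF \<Gamma>(1)] \<Gamma>(2)] continuous_intros comp c\<sigma>' v)
    show "smooth_off_0 H (\<lambda>\<xi>. \<eta>' (\<Gamma> \<xi>) * - v (\<Gamma> \<xi>))" if "G \<noteq> 0"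
      unfolding H_def
      by (intro smooth_off_0_C1 DERIV_chain2[OF \<eta>'(1)[OF that \<Gamma>(1)] \<Gamma>(2)] continuous_intros comp \<eta>'(2) that v)
    show "smooth_off_0 \<Gamma> (\<lambda>\<xi>. - v (\<Gamma> \<xi>))"
      by (intro smooth_off_0_C1 \<Gamma>(2) continuous_intros comp v)
  qed (use flux1[OF \<Gamma>(1)] flux2[OF \<Gamma>(1)] in \<open>simp_all only: H_def\<close>)
  \<comment> \<open>\<Gamma> never attains 0 or 1, so its limits are one-sided and the boundary
    limits of \<eta> can be composed with it.\<close>
  moreover have "filterlim \<Gamma> (at_left 1) at_bot" "filterlim \<Gamma> (at_right 0) at_top"
    using \<Gamma>(1,4,5) by (auto simp: filterlim_at less_imp_neq less_imp_neq[symmetric])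
  then have "(H \<longlongrightarrow> 2 * h) at_bot" "(H \<longlongrightarrow> h) at_top"
    unfolding H_def[abs_def] using filterlim_compose \<eta>(3,4) by blast+
  ultimately show ?thesis using \<Gamma>(3-5) by blast
qed

end

section \<open>Waves without diffusion or without gravity\<close>

context surface_tension begin

text \<open>The front decouples the equations: behind it the height is constant and the affine
  surface tension balances both fluxes, ahead of it \<Gamma> vanishes and only the scalar height
  equation is left.\<close>

lemma wave_no_diffusion:
  assumes h: "0 < h" and G: "0 \<le> G"
  shows "\<exists>H \<Gamma>. weak_solution 0 G \<sigma> {0<..} (\<lambda>(t, x). H (x - t)) (\<lambda>(t, x). \<Gamma> (x - t)) \<and>
      (H \<longlongrightarrow> 2 * h) at_bot \<and> (H \<longlongrightarrow> h) at_top \<and> (\<Gamma> \<longlongrightarrow> 1) at_bot \<and> (\<Gamma> \<longlongrightarrow> 0) at_top \<and> antimono \<Gamma>"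
proof -
  obtain \<Gamma> where \<Gamma>: "antimono \<Gamma>" "\<And>\<xi>. 0 \<le> \<Gamma> \<xi> \<and> \<Gamma> \<xi> < 1" "\<And>\<xi>. 0 \<le> \<xi> \<Longrightarrow> \<Gamma> \<xi> = 0"
    "smooth_off_0 (\<lambda>\<xi>. \<sigma> (\<Gamma> \<xi>)) (\<lambda>\<xi>. if \<xi> < 0 then 1 / (2 * h) else 0)"
    "(\<Gamma> \<longlongrightarrow> 1) at_bot" "(\<Gamma> \<longlongrightarrow> 0) at_top"
    using surfactant_front[OF h] by blast
  \<comment> \<open>A common description of both heights. For \<open>G = 0\<close> the height jumps
    and \<open>H'\<close> is a dummy zero, since it occurs only multiplied by
    \<open>G\<close>.\<close>
  have "\<exists>H H'. H \<in> borel_measurable borel \<and> (G \<noteq> 0 \<longrightarrow> smooth_off_0 H H') \<and> (\<forall>\<xi>. h \<le> H \<xi> \<and> H \<xi> \<le> 2 * h) \<and>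
    (\<forall>\<xi><0. H \<xi> = 2 * h \<and> H' \<xi> = 0) \<and> (\<forall>\<xi>\<ge>0. - (G / 3 * H \<xi> ^ 3 * H' \<xi>) = H \<xi> - h) \<and>
    (H \<longlongrightarrow> 2 * h) at_bot \<and> (H \<longlongrightarrow> h) at_top"
  proof (cases "G = 0")
    case True
    let ?H = "\<lambda>\<xi>::real. if \<xi> < 0 then 2 * h else h"
    have "(?H \<longlongrightarrow> 2 * h) at_bot"
      by (rule tendsto_eventually, rule eventually_mono[OF eventually_le_at_bot[of "-1"]]) simp
    moreover have "(?H \<longlongrightarrow> h) at_top"
      by (rule tendsto_eventually, rule eventually_mono[OF eventually_ge_at_top[of 0]]) simp
    ultimately show ?thesis using True h by (intro exI[of _ ?H] exI[of _ "\<lambda>_. 0"]) auto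
  next
    case False
    then obtain H where H: "smooth_off_0 H (\<lambda>\<xi>. if \<xi> < 0 then 0 else - 3 * (H \<xi> - h) / (G * H \<xi> ^ 3))"
      "\<And>\<xi>. h \<le> H \<xi> \<and> H \<xi> \<le> 2 * h" "\<And>\<xi>. \<xi> < 0 \<Longrightarrow> H \<xi> = 2 * h" "(H \<longlongrightarrow> 2 * h) at_bot" "(H \<longlongrightarrow> h) at_top"
      using draining_profile[OF h, of G] G by auto
    define H' where "H' \<xi> = (if \<xi> < 0 then 0 else - 3 * (H \<xi> - h) / (G * H \<xi> ^ 3))" for \<xi>
    have "smooth_off_0 H H'" using H(1) unfolding H'_def[abs_def] .
    moreover have "H' \<xi> = 0" if "\<xi> < 0" for \<xi> using that by (simp add: H'_def)
    moreover have "- (G / 3 * H \<xi> ^ 3 * H' \<xi>) = H \<xi> - h" if "0 \<le> \<xi>" for \<xi>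
    proof -
      have "H \<xi> \<noteq> 0" using H(2)[of \<xi>] h by auto
      then show ?thesis using False that by (simp add: H'_def field_simps)
    qed
    ultimately show ?thesis
      using H(2-5) smooth_off_0_measurable(1)[OF H(1)] by (intro exI[of _ H] exI[of _ H']) auto
  qed
  then obtain H H' where H: "H \<in> borel_measurable borel" "G \<noteq> 0 \<Longrightarrow> smooth_off_0 H H'" "\<And>\<xi>. h \<le> H \<xi> \<and> H \<xi> \<le> 2 * h"
    "\<And>\<xi>. \<xi> < 0 \<Longrightarrow> H \<xi> = 2 * h \<and> H' \<xi> = 0" "\<And>\<xi>. 0 \<le> \<xi> \<Longrightarrow> - (G / 3 * H \<xi> ^ 3 * H' \<xi>) = H \<xi> - h"
    "(H \<longlongrightarrow> 2 * h) at_bot" "(H \<longlongrightarrow> h) at_top"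
    by auto
  let ?s = "\<lambda>\<xi>. if \<xi> < 0 then 1 / (2 * h) else 0"
  have "weak_solution 0 G \<sigma> {0<..} (\<lambda>(t, x). H (x - t)) (\<lambda>(t, x). \<Gamma> (x - t))"
  proof (rule weak_solution_travelling[OF h H(1,3) \<Gamma>(1,2,4) H(2)])
    fix \<xi> :: real
    show "(H \<xi>)\<^sup>2 / 2 * ?s \<xi> - G / 3 * H \<xi> ^ 3 * H' \<xi> = H \<xi> - h"
      using H(4,5)[of \<xi>] h by (cases "\<xi> < 0") (auto simp: power2_eq_square)
    show "H \<xi> * \<Gamma> \<xi> * ?s \<xi> - 0 * 0 - G / 2 * \<Gamma> \<xi> * (H \<xi>)\<^sup>2 * H' \<xi> = \<Gamma> \<xi>"
      using H(4)[of \<xi>] \<Gamma>(3)[of \<xi>] h by (cases "\<xi> < 0") auto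
  qed auto
  then show ?thesis using H(6,7) \<Gamma>(1,5,6) by blast
qed

lemma continuous': "continuous_on {0<..<1} \<sigma>'"
  using cont' by (rule continuous_on_subset) auto

lemma deriv_at_0: "(\<sigma>' \<longlongrightarrow> \<sigma>' 0) (at_right 0)"
proof -
  have "continuous_on {0..1/2} \<sigma>'" using cont' by (rule continuous_on_subset) auto
  then have "(\<sigma>' \<longlongrightarrow> \<sigma>' 0) (at 0 within {0..1/2})" by (simp add: continuous_on_def)
  then show ?thesis by (simp add: at_within_Icc_at_right)
qed

text \<open>The second flux identity gives \<open>v = 1 / X\<close>. Substituting this in the first
  leaves the quadratic equation \<open>\<eta> ^ 2 / 2 = (\<eta> - h) * (\<eta> + r)\<close>, whose
  positive root is the \<eta> below. It tends to \<open>2 * h\<close> as \<open>r\<close> tends to 0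
  and to \<open>h\<close> as \<open>r\<close> tends to infinity.\<close>

lemma wave_no_gravity:
  assumes h: "0 < h" and D: "0 < D" and blowup: "filterlim \<sigma>' at_bot (at_left 1)"
  shows "\<exists>H \<Gamma>. weak_solution D 0 \<sigma> {0<..} (\<lambda>(t, x). H (x - t)) (\<lambda>(t, x). \<Gamma> (x - t)) \<and>
      (H \<longlongrightarrow> 2 * h) at_bot \<and> (H \<longlongrightarrow> h) at_top \<and> (\<Gamma> \<longlongrightarrow> 1) at_bot \<and> (\<Gamma> \<longlongrightarrow> 0) at_top \<and> antimono \<Gamma>"
proof -
  define r where "r z = D / (z * - \<sigma>' z)" for z
  define \<eta> where "\<eta> z = h + (sqrt ((r z)\<^sup>2 + h\<^sup>2) - r z)" for z
  define X where "X z = \<eta> z * (- \<sigma>' z) + D / z" for z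
  have pos: "0 < - \<sigma>' z" if "z \<in> {0<..<1}" for z using neg[of z] that by auto
  have nz: "\<sigma>' z \<noteq> 0" if "z \<in> {0<..<1}" for z using pos[OF that] by auto
  have rpos: "0 < r z" if "z \<in> {0<..<1}" for z
    unfolding r_def using pos[OF that] D that by (intro divide_pos_pos mult_pos_pos) auto
  have \<eta>b: "h \<le> \<eta> z \<and> \<eta> z \<le> 2 * h" if "z \<in> {0<..<1}" for z
  proof -
    have "r z \<le> sqrt ((r z)\<^sup>2 + h\<^sup>2)" by (rule real_le_rsqrt) simp
    moreover have "sqrt ((r z)\<^sup>2 + h\<^sup>2) \<le> r z + h"
      using rpos[OF that] h by (intro real_le_lsqrt) (auto simp: power2_sum)
    ultimately show ?thesis by (simp add: \<eta>_def)
  qed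
  have Xpos: "0 < X z" if "z \<in> {0<..<1}" for z
    unfolding X_def using \<eta>b[OF that] pos[OF that] h D that by (intro add_pos_pos mult_pos_pos divide_pos_pos) auto
  have cr: "continuous_on {0<..<1} r"
    unfolding r_def using nz by (intro continuous_intros continuous') auto
  have c\<eta>: "continuous_on {0<..<1} \<eta>"
    unfolding \<eta>_def by (intro continuous_intros cr)
  have cX: "continuous_on {0<..<1} X"
    unfolding X_def by (intro continuous_intros c\<eta> continuous') auto
  have key: "(\<eta> z)\<^sup>2 / 2 = (\<eta> z - h) * (\<eta> z + r z)" for z
  proof -
    define q where "q = sqrt ((r z)\<^sup>2 + h\<^sup>2)"
    have "q\<^sup>2 = (r z)\<^sup>2 + h\<^sup>2" by (simp add: q_def)
    then have "(h + (q - r z))\<^sup>2 = 2 * ((h + (q - r z) - h) * (h + (q - r z) + r z))" by algebra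
    then show ?thesis unfolding \<eta>_def q_def[symmetric] by simp
  qed
  have lim1: "(\<eta> \<longlongrightarrow> 2 * h) (at_left 1)"
  proof -
    have "filterlim (\<lambda>z. - \<sigma>' z) at_top (at_left 1)" using blowup by (simp add: filterlim_uminus_at_top)
    then have "((\<lambda>z. inverse (- \<sigma>' z)) \<longlongrightarrow> 0) (at_left 1)" by (rule tendsto_inverse_0_at_top)
    then have "((\<lambda>z. D / z * inverse (- \<sigma>' z)) \<longlongrightarrow> D / 1 * 0) (at_left 1)"
      by (intro tendsto_intros) auto
    then have "(r \<longlongrightarrow> 0) (at_left 1)"
      unfolding r_def[abs_def] by (simp add: divide_inverse mult.assoc)
    then have "(\<eta> \<longlongrightarrow> h + (sqrt (0\<^sup>2 + h\<^sup>2) - 0)) (at_left 1)"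
      unfolding \<eta>_def[abs_def] by (intro tendsto_intros)
    then show ?thesis using h by simp
  qed
  have lim0: "(\<eta> \<longlongrightarrow> h) (at_right 0)"
  proof -
    \<comment> \<open>Majorant for \<open>\<eta> z - h\<close>: rationalizing the difference of root
      and \<open>r\<close> bounds it by \<open>h ^ 2 / r z\<close>, which is this
      expression.\<close>
    have "((\<lambda>z. h\<^sup>2 * (z * - \<sigma>' z) / D) \<longlongrightarrow> h\<^sup>2 * (0 * - \<sigma>' 0) / D) (at_right 0)"
      using D by (intro tendsto_intros deriv_at_0) auto
    then have L: "((\<lambda>z. h\<^sup>2 * (z * - \<sigma>' z) / D) \<longlongrightarrow> 0) (at_right 0)" by simp
    have ev: "\<forall>\<^sub>F z in at_right 0. z \<in> {0<..<1::real}" by (rule eventually_at_right_real) simp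
    have "((\<lambda>z. \<eta> z - h) \<longlongrightarrow> 0) (at_right 0)"
    proof (rule Lim_null_comparison[OF _ L])
      show "\<forall>\<^sub>F z in at_right 0. norm (\<eta> z - h) \<le> h\<^sup>2 * (z * - \<sigma>' z) / D"
        using ev
      proof eventually_elim
        case (elim z)
        define q where "q = sqrt ((r z)\<^sup>2 + h\<^sup>2)"
        have q: "r z \<le> q" unfolding q_def by (rule real_le_rsqrt) simp
        have "(q - r z) * (q + r z) = h\<^sup>2" by (simp add: q_def algebra_simps flip: power2_eq_square)
        moreover have "(q - r z) * r z \<le> (q - r z) * (q + r z)"
          using q rpos[OF elim] by (intro mult_left_mono) auto
        ultimately have "q - r z \<le> h\<^sup>2 / r z" using rpos[OF elim] by (simp add: field_simps)
        moreover have "\<eta> z - h = q - r z" by (simp add: \<eta>_def q_def)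
        moreover have "h\<^sup>2 * (z * - \<sigma>' z) / D = h\<^sup>2 / r z" by (simp add: r_def)
        ultimately show ?case using q by simp
      qed
    qed
    then show ?thesis by (simp add: LIM_zero_iff)
  qed
  show ?thesis
  \<comment> \<open>Both summands of \<open>X\<close> are nonnegative and \<eta> is at least
    \<open>h\<close>, so \<open>X\<close> dominates \<open>h * (- \<sigma>')\<close> and
    \<open>D / z\<close>; this is the choice of \<open>c\<close>.\<close>
  proof (rule advected_wave[where \<eta>=\<eta> and \<eta>'="\<lambda>_. 0" and v="\<lambda>z. 1 / X z" and c="min h D", OF h c\<eta> \<eta>b lim1 lim0])
    show "continuous_on {0<..<1} (\<lambda>z. 1 / X z)"
      using Xpos by (intro continuous_intros cX) (auto simp: less_imp_neq[symmetric])
    show "0 < min h D" using h D by simp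
    fix z :: real assume z: "z \<in> {0<..<1}"
    show "0 < 1 / X z" using Xpos[OF z] by simp
    have "min h D * (- \<sigma>' z) \<le> \<eta> z * (- \<sigma>' z)"
      using pos[OF z] \<eta>b[OF z] by (intro mult_right_mono) auto
    moreover have "0 \<le> D / z" using D z by simp
    ultimately show "min h D * (- \<sigma>' z) \<le> 1 / (1 / X z)" by (simp add: X_def)
    have "min h D / z \<le> D / z" using z by (intro divide_right_mono) auto
    moreover have "0 \<le> \<eta> z * (- \<sigma>' z)" using pos[OF z] \<eta>b[OF z] h by (intro mult_nonneg_nonneg) auto
    ultimately show "min h D / z \<le> 1 / (1 / X z)" by (simp add: X_def)
    have X: "X z = (\<eta> z + r z) * (- \<sigma>' z)"
      unfolding X_def r_def using nz[OF z] z by (simp add: field_simps)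
    have "(\<eta> z)\<^sup>2 / 2 * (\<sigma>' z * - (1 / X z)) = (\<eta> z)\<^sup>2 / 2 * (- \<sigma>' z) / X z" by simp
    also have "\<dots> = (\<eta> z - h) * X z / X z" unfolding key X by (simp add: mult.assoc)
    also have "\<dots> = \<eta> z - h" using Xpos[OF z] by simp
    finally show "(\<eta> z)\<^sup>2 / 2 * (\<sigma>' z * - (1 / X z)) - 0 / 3 * \<eta> z ^ 3 * (0 * - (1 / X z)) = \<eta> z - h" by simp
    have "\<eta> z * z * (\<sigma>' z * - (1 / X z)) - D * - (1 / X z) = (\<eta> z * z * (- \<sigma>' z) + D) / X z"
      by (simp add: add_divide_distrib diff_divide_distrib)
    also have "\<eta> z * z * (- \<sigma>' z) + D = z * X z" unfolding X_def using z by (simp add: field_simps)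
    also have "z * X z / X z = z" using Xpos[OF z] by simp
    finally show "\<eta> z * z * (\<sigma>' z * - (1 / X z)) - D * - (1 / X z) - 0 / 2 * z * (\<eta> z)\<^sup>2 * (0 * - (1 / X z)) = z" by simp
  qed auto
qed

end

section \<open>Waves with gravity and diffusion\<close>

context surface_tension begin

text \<open>Eliminating \<open>v\<close> from the two flux identities leaves an equation linear in
  \<open>\<eta>'\<close> with coefficient \<open>G / 6 * \<eta> ^ 2 * (3 * h - \<eta>)\<close>,
  nonzero on the range of \<eta>. A change of the independent variable brings it to the form solved
  by the height equation lemma.\<close>

lemma wave_gravity_diffusion:
  assumes h: "0 < h" and D: "0 < D" and G: "0 < G" and blowup: "filterlim \<sigma>' at_bot (at_left 1)"
  shows "\<exists>H \<Gamma>. weak_solution D G \<sigma> {0<..} (\<lambda>(t, x). H (x - t)) (\<lambda>(t, x). \<Gamma> (x - t)) \<and>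
      (H \<longlongrightarrow> 2 * h) at_bot \<and> (H \<longlongrightarrow> h) at_top \<and> (\<Gamma> \<longlongrightarrow> 1) at_bot \<and> (\<Gamma> \<longlongrightarrow> 0) at_top \<and> antimono \<Gamma>"
proof -
  obtain \<kappa> where \<kappa>: "0 < \<kappa>"
    "\<And>w. continuous_on UNIV w \<Longrightarrow> (\<And>\<tau>. 0 \<le> w \<tau> \<and> w \<tau> \<le> 1) \<Longrightarrow> (w \<longlongrightarrow> 0) at_bot \<Longrightarrow> (w \<longlongrightarrow> 1) at_top \<Longrightarrow>
      \<exists>u. (\<forall>\<tau>. h \<le> u \<tau> \<and> u \<tau> \<le> 2 * h) \<and> (u \<longlongrightarrow> 2 * h) at_bot \<and> (u \<longlongrightarrow> h) at_top \<and>
        (\<forall>\<tau>. (u has_real_derivative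
            - \<kappa> * (w \<tau> * ((u \<tau> - h) / ((u \<tau>)\<^sup>2 * (3 * h - u \<tau>)))
              - (1 - w \<tau>) * ((2 * h - u \<tau>) / (2 * u \<tau> * (3 * h - u \<tau>))))) (at \<tau>))"
    using height_equation_solvable[OF h] by blast
  \<comment> \<open>Sets the speed of the new variable so that \<open>\<kappa> * C\<close> is the
    factor \<open>6 / G\<close> in \<open>\<eta>'\<close>.\<close>
  define C where "C = 6 / (G * \<kappa>)"
  have C: "0 < C" using G \<kappa> by (simp add: C_def)
  have pos: "0 < - \<sigma>' z" if "z \<in> {0<..<1}" for z using neg[of z] that by auto
  have Dz: "0 < D / z" if "z \<in> {0<..<1}" for z using D that by simp
  define Y where "Y z = D / z - \<sigma>' z" for z
  have Ypos: "0 < Y z" if "z \<in> {0<..<1}" for z using pos[OF that] Dz[OF that] by (simp add: Y_def)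
  have cY: "continuous_on {0<..<1} Y"
    unfolding Y_def by (intro continuous_intros continuous') auto
  have cv: "continuous_on {0<..<1} (\<lambda>z. 1 / (C * Y z))" "\<And>z. z \<in> {0<..<1} \<Longrightarrow> 0 < 1 / (C * Y z)"
    using Ypos C by (auto intro!: continuous_intros cY simp: less_imp_neq[symmetric])
  \<comment> \<open>\<open>decreasing_profile\<close> is applied here to the change of variable, not
    to the wave: \<open>P\<close> sends \<open>z\<close> to the new variable \<tau>, and
    \<open>Q\<close> is its inverse.\<close>
  obtain P Q where P: "\<And>z. z \<in> {0<..<1} \<Longrightarrow> (P has_real_derivative - (C * Y z)) (at z)"
    and Q: "\<And>\<tau>. Q \<tau> \<in> {0<..<1}" "\<And>z. z \<in> {0<..<1} \<Longrightarrow> Q (P z) = z" "continuous_on UNIV Q"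
      "filterlim Q (at_left 1) at_bot" "filterlim Q (at_right 0) at_top"
    and Plim: "filterlim P at_top (at_right 0)" "filterlim P at_bot (at_left 1)"
  proof (rule decreasing_profile[OF cv, of "C * min 1 D"])
    show "0 < C * min 1 D" using C D by simp
    fix z :: real assume z: "z \<in> {0<..<1}"
    have "min 1 D * (- \<sigma>' z) \<le> 1 * (- \<sigma>' z)" using pos[OF z] by (intro mult_right_mono) auto
    then have "min 1 D * (- \<sigma>' z) \<le> Y z" using Dz[OF z] by (simp add: Y_def)
    from mult_left_mono[OF this, of C] C show "C * min 1 D * (- \<sigma>' z) \<le> 1 / (1 / (C * Y z))" by (simp add: mult.assoc)
    have "min 1 D / z \<le> D / z" using z by (intro divide_right_mono) auto
    then have "min 1 D / z \<le> Y z" using pos[OF z] by (simp add: Y_def)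
    from mult_left_mono[OF this, of C] C show "C * min 1 D / z \<le> 1 / (1 / (C * Y z))" by simp
  next
    fix P Q :: "real \<Rightarrow> real"
    assume P: "\<And>z. z \<in> {0<..<1} \<Longrightarrow> (P has_real_derivative - (1 / (1 / (C * Y z)))) (at z)"
      and Q: "\<And>\<xi>. Q \<xi> \<in> {0<..<1}" "\<And>z. z \<in> {0<..<1} \<Longrightarrow> Q (P z) = z"
        "\<And>\<xi>. (Q has_real_derivative - (1 / (C * Y (Q \<xi>)))) (at \<xi>)" "(Q \<longlongrightarrow> 1) at_bot" "(Q \<longlongrightarrow> 0) at_top"
      and lims: "filterlim P at_top (at_right 0)" "filterlim P at_bot (at_left 1)"
    show thesis
    proof (rule that[OF _ Q(1,2) _ _ _ lims])
      show "(P has_real_derivative - (C * Y z)) (at z)" if "z \<in> {0<..<1}" for z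
        using P[OF that] by simp
      show "continuous_on UNIV Q" using Q(3) by (meson DERIV_isCont continuous_at_imp_continuous_on)
      show "filterlim Q (at_left 1) at_bot" "filterlim Q (at_right 0) at_top"
        using Q(1,4,5) by (auto simp: filterlim_at less_imp_neq less_imp_neq[symmetric])
    qed
  qed
  \<comment> \<open>The share of \<open>D / z\<close> in \<open>Y z\<close>, multiplied through by
    \<open>z\<close> so that its limit at 0 is visible; the complementary share belongs to
    \<open>- \<sigma>' z\<close>.\<close>
  define \<omega> where "\<omega> z = D / (D + z * - \<sigma>' z)" for z
  have zs: "0 < z * - \<sigma>' z" if "z \<in> {0<..<1}" for z using mult_pos_pos[OF _ pos[OF that]] that by auto
  have \<omega>Y: "\<omega> z * Y z = D / z" "(1 - \<omega> z) * Y z = - \<sigma>' z" if "z \<in> {0<..<1}" for z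
  proof -
    define X where "X = D + z * - \<sigma>' z"
    have X: "X \<noteq> 0" "z \<noteq> 0" "Y z = X / z" using zs[OF that] D that by (auto simp: X_def Y_def diff_divide_distrib)
    have \<omega>: "\<omega> z = D / X" by (simp only: \<omega>_def X_def)
    have "1 - \<omega> z = (X - D) / X" using X by (simp add: \<omega> diff_divide_distrib)
    also have "X - D = z * - \<sigma>' z" by (simp add: X_def)
    finally show "(1 - \<omega> z) * Y z = - \<sigma>' z" using X by simp
    show "\<omega> z * Y z = D / z" using X by (simp add: \<omega>)
  qed
  have c\<omega>: "continuous_on {0<..<1} \<omega>"
    unfolding \<omega>_def using zs D by (intro continuous_intros continuous') force
  have "continuous_on UNIV (\<lambda>\<tau>. \<omega> (Q \<tau>))"
    by (rule continuous_on_compose2[OF c\<omega> Q(3)]) (use Q(1) in auto)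
  moreover have "0 \<le> \<omega> (Q \<tau>) \<and> \<omega> (Q \<tau>) \<le> 1" for \<tau>
    using zs[OF Q(1)[of \<tau>]] D unfolding \<omega>_def by (auto intro!: divide_nonneg_nonneg simp: divide_le_eq_1)
  moreover have "((\<lambda>\<tau>. \<omega> (Q \<tau>)) \<longlongrightarrow> 0) at_bot"
  proof (rule filterlim_compose[OF _ Q(4)])
    have "filterlim (\<lambda>z. - \<sigma>' z) at_top (at_left 1)" using blowup by (simp add: filterlim_uminus_at_top)
    then have "filterlim (\<lambda>z. z * - \<sigma>' z) at_top (at_left 1)"
      by (intro filterlim_tendsto_pos_mult_at_top[where c=1]) (auto intro: tendsto_ident_at)
    then have "filterlim (\<lambda>z. D + z * - \<sigma>' z) at_top (at_left 1)"
      by (rule filterlim_tendsto_add_at_top[OF tendsto_const])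
    then show "(\<omega> \<longlongrightarrow> 0) (at_left 1)"
      unfolding \<omega>_def[abs_def] by (rule tendsto_divide_0[OF tendsto_const filterlim_at_top_imp_at_infinity])
  qed
  moreover have "((\<lambda>\<tau>. \<omega> (Q \<tau>)) \<longlongrightarrow> 1) at_top"
  proof (rule filterlim_compose[OF _ Q(5)])
    have "(\<omega> \<longlongrightarrow> D / (D + 0 * - \<sigma>' 0)) (at_right 0)"
      unfolding \<omega>_def[abs_def] using D by (intro tendsto_intros deriv_at_0) auto
    then show "(\<omega> \<longlongrightarrow> 1) (at_right 0)" using D by simp
  qed
  ultimately obtain u where u: "\<And>\<tau>. h \<le> u \<tau> \<and> u \<tau> \<le> 2 * h" "(u \<longlongrightarrow> 2 * h) at_bot" "(u \<longlongrightarrow> h) at_top"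
    "\<And>\<tau>. (u has_real_derivative
            - \<kappa> * (\<omega> (Q \<tau>) * ((u \<tau> - h) / ((u \<tau>)\<^sup>2 * (3 * h - u \<tau>)))
              - (1 - \<omega> (Q \<tau>)) * ((2 * h - u \<tau>) / (2 * u \<tau> * (3 * h - u \<tau>))))) (at \<tau>)"
    using \<kappa>(2)[of "\<lambda>\<tau>. \<omega> (Q \<tau>)"] by blast
  define \<eta> where "\<eta> z = u (P z)" for z
  \<comment> \<open>The derivative of \<eta> with respect to \<open>z\<close>, as obtained by
    eliminating \<open>v\<close>.\<close>
  define \<eta>' where "\<eta>' z = 6 / G * (D / z * ((\<eta> z - h) / ((\<eta> z)\<^sup>2 * (3 * h - \<eta> z)))
      - (- \<sigma>' z) * ((2 * h - \<eta> z) / (2 * \<eta> z * (3 * h - \<eta> z))))" for z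
  have \<eta>b: "h \<le> \<eta> z \<and> \<eta> z \<le> 2 * h" for z using u(1) by (simp add: \<eta>_def)
  have \<eta>nz: "\<eta> z \<noteq> 0" "3 * h - \<eta> z \<noteq> 0" for z using \<eta>b[of z] h by auto
  have d\<eta>: "(\<eta> has_real_derivative \<eta>' z) (at z)" if z: "z \<in> {0<..<1}" for z
  proof -
    define a where "a = (\<eta> z - h) / ((\<eta> z)\<^sup>2 * (3 * h - \<eta> z))"
    define b where "b = (2 * h - \<eta> z) / (2 * \<eta> z * (3 * h - \<eta> z))"
    have "(\<eta> has_real_derivative - \<kappa> * (\<omega> z * a - (1 - \<omega> z) * b) * (- (C * Y z))) (at z)"
      using DERIV_chain2[OF u(4) P[OF z]] unfolding \<eta>_def[abs_def] a_def b_def \<eta>_def Q(2)[OF z] .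
    moreover have "- \<kappa> * (\<omega> z * a - (1 - \<omega> z) * b) * (- (C * Y z)) = \<kappa> * C * ((\<omega> z * Y z) * a - ((1 - \<omega> z) * Y z) * b)"
      by algebra
    moreover have "\<kappa> * C = 6 / G" using \<kappa>(1) G by (simp add: C_def)
    ultimately show ?thesis
      unfolding \<omega>Y[OF z] \<eta>'_def a_def b_def by simp
  qed
  have c\<eta>: "continuous_on {0<..<1} \<eta>"
    using d\<eta> by (meson DERIV_isCont continuous_at_imp_continuous_on)
  have c\<eta>': "continuous_on {0<..<1} \<eta>'"
    unfolding \<eta>'_def using \<eta>nz G by (intro continuous_intros c\<eta> continuous') auto
  \<comment> \<open>The reciprocal of \<open>v\<close>: inserting \<open>\<eta>'\<close> into
    \<open>\<eta> * (- \<sigma>') + D / z + G / 2 * \<eta> ^ 2 * \<eta>'\<close>, which the second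
    flux identity prescribes, cancels \<open>G\<close>.\<close>
  define X where "X z = (\<eta> z)\<^sup>2 / (2 * (3 * h - \<eta> z)) * (- \<sigma>' z) + 2 * \<eta> z / (3 * h - \<eta> z) * (D / z)" for z
  have cX: "continuous_on {0<..<1} X"
    unfolding X_def using \<eta>nz by (intro continuous_intros c\<eta> continuous') auto
  \<comment> \<open>For \<eta> between \<open>h\<close> and \<open>2 * h\<close> one has
    \<open>3 * h - \<eta> \<le> 2 * h\<close>, so the first coefficient of \<open>X\<close> is at
    least \<open>h / 4\<close> and the second at least 1. This yields
    \<open>c = min (h / 4) D\<close>.\<close>
  have X1: "h / 4 * (- \<sigma>' z) \<le> (\<eta> z)\<^sup>2 / (2 * (3 * h - \<eta> z)) * (- \<sigma>' z)" if z: "z \<in> {0<..<1}" for z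
  proof (intro mult_right_mono)
    have "h\<^sup>2 / (2 * (2 * h)) \<le> (\<eta> z)\<^sup>2 / (2 * (3 * h - \<eta> z))"
      using \<eta>b[of z] h by (intro frac_le power_mono) auto
    then show "h / 4 \<le> (\<eta> z)\<^sup>2 / (2 * (3 * h - \<eta> z))" using h by (simp add: power2_eq_square)
    show "0 \<le> - \<sigma>' z" using pos[OF z] by simp
  qed
  have X2: "D / z \<le> 2 * \<eta> z / (3 * h - \<eta> z) * (D / z)" if z: "z \<in> {0<..<1}" for z
  proof -
    have "1 \<le> 2 * \<eta> z / (3 * h - \<eta> z)" using \<eta>b[of z] h by (simp add: le_divide_eq)
    from mult_right_mono[OF this, of "D / z"] show ?thesis using Dz[OF z] by simp
  qed
  have nonneg: "0 \<le> h / 4 * (- \<sigma>' z)" "0 \<le> D / z" if z: "z \<in> {0<..<1}" for z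
    by (rule mult_nonneg_nonneg; use pos[OF z] h in simp) (use Dz[OF z] in simp)
  have Xpos: "0 < X z" if z: "z \<in> {0<..<1}" for z
    using X1[OF z] X2[OF z] nonneg[OF z] Dz[OF z] by (simp only: X_def)
  have lim1: "(\<eta> \<longlongrightarrow> 2 * h) (at_left 1)"
    unfolding \<eta>_def[abs_def] by (rule filterlim_compose[OF u(2) Plim(2)])
  have lim0: "(\<eta> \<longlongrightarrow> h) (at_right 0)"
    unfolding \<eta>_def[abs_def] by (rule filterlim_compose[OF u(3) Plim(1)])
  show ?thesis
  proof (rule advected_wave[where \<eta>=\<eta> and \<eta>'=\<eta>' and v="\<lambda>z. 1 / X z" and c="min (h / 4) D", OF h c\<eta> \<eta>b lim1 lim0 d\<eta> c\<eta>'])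
    show "continuous_on {0<..<1} (\<lambda>z. 1 / X z)"
      using Xpos by (intro continuous_intros cX) (auto simp: less_imp_neq[symmetric])
    show "0 < min (h / 4) D" using h D by simp
    fix z :: real assume z: "z \<in> {0<..<1}"
    show "0 < 1 / X z" using Xpos[OF z] by simp
    have "min (h / 4) D * (- \<sigma>' z) \<le> h / 4 * (- \<sigma>' z)"
      using pos[OF z] by (intro mult_right_mono) auto
    then have "min (h / 4) D * (- \<sigma>' z) \<le> X z"
      using X1[OF z] X2[OF z] nonneg[OF z] unfolding X_def by linarith
    then show "min (h / 4) D * (- \<sigma>' z) \<le> 1 / (1 / X z)" by simp
    have "min (h / 4) D / z \<le> D / z" using z by (intro divide_right_mono) auto
    then have "min (h / 4) D / z \<le> X z"
      using X1[OF z] X2[OF z] nonneg[OF z] unfolding X_def by linarith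
    then show "min (h / 4) D / z \<le> 1 / (1 / X z)" by simp
    note nz = \<eta>nz[of z]
    have z0: "z \<noteq> 0" using z by simp
    have "(\<eta> z)\<^sup>2 / 2 * (- \<sigma>' z) + G / 3 * \<eta> z ^ 3 * \<eta>' z = (\<eta> z - h) * X z"
      unfolding \<eta>'_def X_def using nz z0 G by (simp add: divide_simps) algebra
    moreover have "(\<eta> z)\<^sup>2 / 2 * (\<sigma>' z * - (1 / X z)) - G / 3 * \<eta> z ^ 3 * (\<eta>' z * - (1 / X z))
        = ((\<eta> z)\<^sup>2 / 2 * (- \<sigma>' z) + G / 3 * \<eta> z ^ 3 * \<eta>' z) / X z"
      by (simp add: add_divide_distrib diff_divide_distrib)
    ultimately show "(\<eta> z)\<^sup>2 / 2 * (\<sigma>' z * - (1 / X z)) - G / 3 * \<eta> z ^ 3 * (\<eta>' z * - (1 / X z)) = \<eta> z - h"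
      using Xpos[OF z] by simp
    have "\<eta> z * z * (- \<sigma>' z) + D + G / 2 * z * (\<eta> z)\<^sup>2 * \<eta>' z = z * X z"
      unfolding \<eta>'_def X_def using nz z0 G by (simp add: divide_simps) algebra
    moreover have "\<eta> z * z * (\<sigma>' z * - (1 / X z)) - D * - (1 / X z) - G / 2 * z * (\<eta> z)\<^sup>2 * (\<eta>' z * - (1 / X z))
        = (\<eta> z * z * (- \<sigma>' z) + D + G / 2 * z * (\<eta> z)\<^sup>2 * \<eta>' z) / X z"
      by (simp add: add_divide_distrib diff_divide_distrib)
    ultimately show "\<eta> z * z * (\<sigma>' z * - (1 / X z)) - D * - (1 / X z) - G / 2 * z * (\<eta> z)\<^sup>2 * (\<eta>' z * - (1 / X z)) = z"
      using Xpos[OF z] by simp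
  qed auto
qed

end

theorem theorem1p1:
  fixes D G :: real and \<sigma> \<sigma>' :: "real \<Rightarrow> real" and Hs :: real
  assumes "0 \<le> D" and "0 \<le> G"
    and "\<And>z. z \<in> {0..<1} \<Longrightarrow> (\<sigma> has_real_derivative \<sigma>' z) (at z within {0..<1})"
    and "continuous_on {0..<1} \<sigma>'"
    and "\<And>z. z \<in> {0..<1} \<Longrightarrow> \<sigma>' z < 0"
    and "\<not> set_integrable lebesgue {0<..<1} \<sigma>'"
    and "\<sigma> 0 > 0"
    and "filterlim \<sigma>' at_bot (at_left 1)"
    and "0 < G \<Longrightarrow> (\<And>z. z \<in> {0<..<1} \<Longrightarrow> \<exists>L. L-lipschitz_on {0..z} (rho \<sigma>'))"
    and "0 < Hs"
  shows "\<exists>H \<Gamma> :: real \<Rightarrow> real.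
      weak_solution D G \<sigma> {0<..} (\<lambda>(t, x). H (x - t)) (\<lambda>(t, x). \<Gamma> (x - t)) \<and>
      (H \<longlongrightarrow> 2 * Hs) at_bot \<and> (H \<longlongrightarrow> Hs) at_top \<and>
      (\<Gamma> \<longlongrightarrow> 1) at_bot \<and> (\<Gamma> \<longlongrightarrow> 0) at_top \<and>
      antimono \<Gamma>"
proof -
  interpret surface_tension \<sigma> \<sigma>' using assms(3-6) by unfold_locales
  \<comment> \<open>Without diffusion the front is sharp whether or not gravity acts. With
    diffusion, \<eta> is an algebraic function for \<open>G = 0\<close> and solves a differential
    equation for \<open>G > 0\<close>.\<close>
  consider "D = 0" | "0 < D" "G = 0" | "0 < D" "0 < G" using assms(1,2) by linarith
  then show ?thesis
  proof cases
    case 1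
    then show ?thesis using wave_no_diffusion[OF assms(10,2)] by simp
  next
    case 2
    then show ?thesis using wave_no_gravity[OF assms(10) _ assms(8)] by simp
  next
    case 3
    then show ?thesis by (rule wave_gravity_diffusion[OF assms(10) _ _ assms(8)])
  qed
qed

end
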